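(* Let $p$ be a prime, let $A$ and $B$ be finite nonzero abelian $p$-groups, and let $\lambda:A\to B$ be a homomorphism. Let $p^b=\exp(B)$, $\mathcal{R}=\{x\in A: |x|\le p^b\}$, $p^{n_1}=\exp(\mathcal{R})$ and $p^c=\exp(\ker\lambda)$. Then $\lambda$ is a non-trivial c-map if and only if there is an integer $k$ with $c\le k<n_1$ such that $\lambda(\mathcal{R})=p^kB$, and $\mathcal{R}/\ker(\lambda)$ is cyclic.
   Context: Groups are written additively; $|x|$ is the order of $x$ and $\exp$ the exponent of a group. A homomorphism $\lambda:A\to B$ of abelian groups is a c-map if $f\circ\lambda\circ g=g\circ\lambda\circ f$ for all $f,g\in\mathrm{Hom}(B,A)$. It is a trivial c-map if $f\circ\lambda\circ g=0$ for all $f,g\in\mathrm{Hom}(B,A)$; a non-trivial c-map is a c-map that is not a trivial c-map. $p^kB=\{p^kx:x\in B\}$. When $c<n_1$ one has $\ker\lambda\subseteq\mathcal{R}$, so the quotient $\mathcal{R}/\ker(\lambda)$ makes sense. *)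

theory Defs
  imports
    "HOL-Algebra.Elementary_Groups"
    "HOL-Algebra.Multiplicative_Group"
    "HOL-Computational_Algebra.Primes"
begin

text \<open>
  Abelian groups are rendered by the locale \<open>comm_group\<close>, hence written multiplicatively:
  \<open>0\<close>, \<open>n x\<close> and \<open>p\<^sup>k B\<close> become \<open>\<one>\<close>, \<open>x [^] n\<close> and \<open>pow_set B (p ^ k)\<close>.
\<close>

definition abelian_p_group :: "nat \<Rightarrow> ('a, 'm) monoid_scheme \<Rightarrow> bool" where
  "abelian_p_group p G \<longleftrightarrow>
     comm_group G \<and> (\<forall>x \<in> carrier G. \<exists>i. group.ord G x = p ^ i)"

definition group_exp :: "('a, 'm) monoid_scheme \<Rightarrow> nat" where
  "group_exp G = (LEAST n. n > 0 \<and> (\<forall>x \<in> carrier G. x [^]\<^bsub>G\<^esub> n = \<one>\<^bsub>G\<^esub>))"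
  \<comment> \<open>only meaningful for groups of bounded exponent, in particular for finite groups\<close>

definition pow_set :: "('a, 'm) monoid_scheme \<Rightarrow> nat \<Rightarrow> 'a set" where
  "pow_set G n = (\<lambda>x. x [^]\<^bsub>G\<^esub> n) ` carrier G"

text \<open>
  Elements of \<open>hom B A\<close> are unconstrained outside \<open>carrier B\<close>, so equality of homomorphisms
  \<open>B \<rightarrow> A\<close> is equality on \<open>carrier B\<close>.
\<close>

definition c_map ::
  "('a, 'm) monoid_scheme \<Rightarrow> ('b, 'n) monoid_scheme \<Rightarrow> ('a \<Rightarrow> 'b) \<Rightarrow> bool" where
  "c_map A B l \<longleftrightarrow> l \<in> hom A B \<and>
     (\<forall>f \<in> hom B A. \<forall>g \<in> hom B A. \<forall>x \<in> carrier B. f (l (g x)) = g (l (f x)))"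

definition trivial_c_map ::
  "('a, 'm) monoid_scheme \<Rightarrow> ('b, 'n) monoid_scheme \<Rightarrow> ('a \<Rightarrow> 'b) \<Rightarrow> bool" where
  "trivial_c_map A B l \<longleftrightarrow> l \<in> hom A B \<and>
     (\<forall>f \<in> hom B A. \<forall>g \<in> hom B A. \<forall>x \<in> carrier B. f (l (g x)) = \<one>\<^bsub>A\<^esub>)"

definition nontrivial_c_map ::
  "('a, 'm) monoid_scheme \<Rightarrow> ('b, 'n) monoid_scheme \<Rightarrow> ('a \<Rightarrow> 'b) \<Rightarrow> bool" where
  "nontrivial_c_map A B l \<longleftrightarrow> c_map A B l \<and> \<not> trivial_c_map A B l"

end

theory Submission
  imports Defs "HOL-Number_Theory.Cong"
begin

text \<open>
  Every homomorphism \<open>B \<rightarrow> A\<close> takes values in \<open>R\<close>, the set of elements of \<open>A\<close> killed by \<open>p\<^sup>b\<close>,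
  so only the restriction of \<open>l\<close> to \<open>R\<close> matters for the c-map condition. Pick \<open>e \<in> B\<close> of order
  \<open>p\<^sup>b\<close> and a character \<open>\<chi>\<close> of \<open>B\<close> with values in the integers modulo \<open>p\<^sup>b\<close> and \<open>\<chi> e = 1\<close>. For
  each \<open>s \<in> R\<close> the map \<open>x \<mapsto> s\<close> to the power \<open>\<chi> x\<close> is then a homomorphism \<open>B \<rightarrow> A\<close> that sends \<open>e\<close>
  to \<open>s\<close>. These explicit homomorphisms play the part of a decomposition of \<open>B\<close> into
  cyclic summands.

  From a non-trivial c-map to the structure: write \<open>\<sigma> s\<close> for \<open>\<chi> (l s)\<close>. Testing the c-map
  condition on the homomorphism attached to \<open>s\<close> and an arbitrary \<open>f\<close> (\<open>c_map_eval\<close>) gives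
  in additive notation \<open>\<chi> x \<cdot> f (l s) = \<sigma> (f x) \<cdot> s\<close>, and as a special case the symmetry
  \<open>\<sigma> s \<cdot> r = \<sigma> r \<cdot> s\<close>. Let \<open>p\<^sup>k\<close> be the largest power of \<open>p\<close> that divides every \<open>\<sigma> s\<close>.
  Non-triviality says \<open>k < n\<^sub>1\<close>, and some \<open>r \<in> R\<close> has \<open>\<sigma> r = p\<^sup>k\<close> (\<open>exists_generator\<close>), so that
  \<open>p\<^sup>k s = \<sigma> s \<cdot> r\<close> for all \<open>s \<in> R\<close>. Hence the kernel of \<open>l\<close> is killed by \<open>p\<^sup>k\<close>, the order of \<open>r\<close>
  is \<open>p\<close> to the power \<open>n\<^sub>1\<close>, and \<open>R\<close> is spanned by \<open>r\<close> and elements killed by \<open>p\<^sup>k\<close>. Elements of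
  \<open>B\<close> on which all homomorphisms to \<open>A\<close> vanish lie in \<open>p\<close> to the power \<open>n\<^sub>1\<close> times \<open>B\<close>, because
  characters separate points from multiples (\<open>residue_char_separates\<close>). This detection
  principle turns the relations between values of homomorphisms into the two inclusions
  between \<open>l R\<close> and \<open>p\<^sup>k B\<close>, which both coincide with the span of \<open>l r\<close> (\<open>image_eq\<close>).

  Conversely, let \<open>R\<close> be spanned by \<open>r\<close> and the kernel, with \<open>l r = p\<^sup>k a\<close>. Both composites
  \<open>f \<circ> l \<circ> g\<close> and \<open>g \<circ> l \<circ> f\<close> send \<open>x\<close> to the same multiple of \<open>p\<^sup>k r\<close>, determined by \<open>f a\<close>, \<open>g a\<close> and
  \<open>p\<^sup>k x\<close> (\<open>nontrivial_c_map_of_cyclic_image\<close>).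
\<close>

section \<open>Powers in abelian groups\<close>

context group
begin

lemma int_pow_of_nat_power:
  "x [^] (int p ^ k) = x [^] (p ^ k)"
  using int_pow_int[of G x "p ^ k"] by simp

lemma int_pow_eq_one_of_dvd:
  fixes m z :: int
  assumes "x \<in> carrier G" "x [^] m = \<one>" "m dvd z"
  shows "x [^] z = \<one>"
  using assms(2,3) dvd_trans unfolding int_pow_eq_id[OF assms(1)] by blast

lemma int_pow_cong:
  fixes m i j :: int
  assumes "x \<in> carrier G" "x [^] m = \<one>" "[i = j] (mod m)"
  shows "x [^] i = x [^] j"
proof -
  have "m dvd i - j"
    using assms(3) unfolding cong_iff_dvd_diff .
  then have one: "x [^] (i - j) = \<one>"
    by (rule int_pow_eq_one_of_dvd[OF assms(1,2)])
  have "x [^] i = x [^] (j + (i - j))"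
    by simp
  also have "\<dots> = x [^] j \<otimes> x [^] (i - j)"
    by (rule int_pow_mult[OF assms(1)])
  also have "\<dots> = x [^] j"
    unfolding one using assms(1) by (intro r_one int_pow_closed)
  finally show ?thesis .
qed

text \<open>
  The two hypotheses on powers of \<open>p\<close> say that the order of \<open>x\<close> is exactly \<open>p ^ Suc n\<close>.
\<close>

lemma prime_power_dvd_of_int_pow_eq_one:
  fixes z :: int
  assumes "prime p" "x \<in> carrier G" "x [^] (int p ^ Suc n) = \<one>" "x [^] (int p ^ n) \<noteq> \<one>"
    and "x [^] z = \<one>"
  shows "int p ^ Suc n dvd z"
proof -
  have "ord x dvd p ^ Suc n" "\<not> ord x dvd p ^ n"
    using assms(3,4) pow_eq_id[OF assms(2)] unfolding int_pow_of_nat_power by blast+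
  then obtain i where "i \<le> Suc n" "ord x = p ^ i"
    using assms(1) divides_primepow_nat by blast
  moreover have "\<not> i \<le> n"
    using \<open>\<not> ord x dvd p ^ n\<close> \<open>ord x = p ^ i\<close> le_imp_power_dvd[of i n p] by auto
  ultimately have "ord x = p ^ Suc n"
    by (metis le_SucE)
  then show ?thesis
    using assms(5) int_pow_eq_id[OF assms(2)] by simp
qed

lemma int_pow_eq_one_cancel_coprime:
  fixes u v :: int
  assumes "x \<in> carrier G" "x [^] m = \<one>" "coprime v m" "x [^] (u * v) = \<one>"
  shows "x [^] u = \<one>"
proof -
  have "int (ord x) dvd m" "int (ord x) dvd u * v"
    using assms(2,4) int_pow_eq_id[OF assms(1)] by blast+
  moreover from this have "coprime (int (ord x)) v"
    using assms(3) coprime_divisors[of "int (ord x)" m v v] by (simp add: coprime_commute[of v])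
  ultimately have "int (ord x) dvd u"
    using coprime_dvd_mult_left_iff by blast
  then show ?thesis
    using int_pow_eq_id[OF assms(1)] by blast
qed

end

text \<open>
  Integer exponents are used throughout, since the values of characters may be negative.
\<close>

lemma pow_set_iff:
  assumes "group G"
  shows "y \<in> pow_set G (p ^ k) \<longleftrightarrow> (\<exists>x \<in> carrier G. y = x [^]\<^bsub>G\<^esub> (int p ^ k))"
  unfolding pow_set_def group.int_pow_of_nat_power[OF assms] by blast

lemma subgroup_pow_set:
  fixes G (structure)
  assumes "comm_group G"
  shows "subgroup (pow_set G n) G"
proof -
  interpret comm_group G by fact
  show ?thesis
  proof (rule subgroupI)
    show "pow_set G n \<subseteq> carrier G" "pow_set G n \<noteq> {}"
      by (auto simp: pow_set_def)
    show "inv a \<in> pow_set G n" if a: "a \<in> pow_set G n" for a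
    proof -
      obtain x where x: "x \<in> carrier G" "a = x [^] n"
        using a unfolding pow_set_def by blast
      then have "inv a = inv x [^] n"
        by (simp add: nat_pow_inv)
      then show ?thesis
        unfolding pow_set_def using x(1) by blast
    qed
    show "a \<otimes> b \<in> pow_set G n" if ab: "a \<in> pow_set G n" "b \<in> pow_set G n" for a b
    proof -
      obtain x y where xy: "x \<in> carrier G" "a = x [^] n" "y \<in> carrier G" "b = y [^] n"
        using ab unfolding pow_set_def by blast
      then have "a \<otimes> b = (x \<otimes> y) [^] n"
        by (simp add: nat_pow_distrib)
      then show ?thesis
        unfolding pow_set_def using xy by blast
    qed
  qed
qed

section \<open>Characters with values in the integers modulo m\<close>

text \<open>
  A homomorphism from the subgroup \<open>H\<close> to the additive group of integers modulo \<open>m\<close>, encoded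
  by integer representatives that are additive only up to congruence. A value can then be
  used directly as an exponent.
\<close>

definition residue_char ::
  "('a, 'm) monoid_scheme \<Rightarrow> 'a set \<Rightarrow> int \<Rightarrow> ('a \<Rightarrow> int) \<Rightarrow> bool" where
  "residue_char G H m \<chi> \<longleftrightarrow> (\<forall>x\<in>H. \<forall>y\<in>H. [\<chi> (x \<otimes>\<^bsub>G\<^esub> y) = \<chi> x + \<chi> y] (mod m))"

context comm_group
begin

lemma residue_char_int_pow:
  fixes i :: int
  assumes H: "subgroup H G" and chi: "residue_char G H m \<chi>" and x: "x \<in> H"
  shows "[\<chi> (x [^] i) = i * \<chi> x] (mod m)"
proof -
  have xc: "x \<in> carrier G"
    using H x subgroup.mem_carrier by metis
  have mem: "x [^] j \<in> H" for j :: int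
    using subgroup_int_pow_closed[OF H x] .
  have step: "[\<chi> (x [^] (j + 1)) = \<chi> (x [^] j) + \<chi> x] (mod m)" for j :: int
    using chi mem[of j] x int_pow_mult[OF xc, of j 1] xc by (simp add: residue_char_def)
  show ?thesis
  proof (induction i rule: int_induct[where k = 0])
    case base
    have "[\<chi> (\<one> \<otimes> \<one>) = \<chi> \<one> + \<chi> \<one>] (mod m)"
      using chi subgroup.one_closed[OF H] unfolding residue_char_def by blast
    then show ?case
      by (simp add: cong_iff_dvd_diff)
  next
    case (step1 i)
    have "[\<chi> (x [^] i) + \<chi> x = i * \<chi> x + \<chi> x] (mod m)"
      using step1 cong_add_rcancel by blast
    then show ?case
      using cong_trans[OF step[of i]] by (simp add: algebra_simps)
  next
    case (step2 i)
    have "[\<chi> (x [^] (i - 1)) + \<chi> x = i * \<chi> x] (mod m)"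
      using cong_trans[OF cong_sym[OF step[of "i - 1"]]] step2 by simp
    then have "[\<chi> (x [^] (i - 1)) + \<chi> x = (i - 1) * \<chi> x + \<chi> x] (mod m)"
      by (simp add: algebra_simps)
    then show ?case
      using cong_add_rcancel by blast
  qed
qed

text \<open>
  The image of \<open>y\<close> in the quotient by \<open>H\<close> has order exactly \<open>p\<close>.
\<close>

lemma int_pow_mem_subgroup_imp_dvd:
  fixes i :: int
  assumes "prime p" "subgroup H G" "y \<in> carrier G" "y \<notin> H" "y [^] int p \<in> H" "y [^] i \<in> H"
  shows "int p dvd i"
proof (rule ccontr)
  assume "\<not> int p dvd i"
  then have "coprime (int p) i"
    using assms(1) prime_imp_coprime by (metis prime_nat_int_transfer)
  then obtain u w where uw: "u * int p + w * i = 1"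
    using bezout_int[of "int p" i] by auto
  have "(y [^] int p) [^] u \<otimes> (y [^] i) [^] w = y [^] (u * int p + w * i)"
    using assms(3) int_pow_pow int_pow_mult by (simp add: mult.commute)
  also have "\<dots> = y"
    unfolding uw using assms(3) by simp
  finally show False
    using assms subgroup_int_pow_closed subgroup.m_closed by metis
qed

text \<open>
  A character on \<open>H\<close> extends to the subgroup spanned by \<open>H\<close> and \<open>y\<close>, where \<open>p\<close> is the order of
  \<open>y\<close> modulo \<open>H\<close>, with any prescribed value \<open>v\<close> at \<open>y\<close> that is compatible with the value at the
  \<open>p\<close>-th power of \<open>y\<close>. That relation generates all relations between \<open>y\<close> and \<open>H\<close>, hence the
  extension is well defined.
\<close>

lemma extend_residue_char_step:
  assumes p: "prime p" and H: "subgroup H G" and chi: "residue_char G H m \<chi>"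
    and y: "y \<in> carrier G" "y \<notin> H" "y [^] int p \<in> H"
    and v: "[int p * v = \<chi> (y [^] int p)] (mod m)"
  shows "\<exists>H' \<chi>'. subgroup H' G \<and> H \<subseteq> H' \<and> y \<in> H' \<and> residue_char G H' m \<chi>' \<and>
           (\<forall>x\<in>H. [\<chi>' x = \<chi> x] (mod m)) \<and> [\<chi>' y = v] (mod m)"
proof -
  define H' where "H' = {u. \<exists>a \<in> H. \<exists>i::int. u = a \<otimes> y [^] i}"
  have Hc: "a \<in> carrier G" if "a \<in> H" for a
    using H that subgroup.mem_carrier by metis
  \<comment> \<open>The value \<open>\<chi> a + i * v\<close> does not depend, modulo \<open>m\<close>, on how an element is written.\<close>
  have well: "[\<chi> a + i * v = \<chi> a' + j * v] (mod m)"
    if "a \<in> H" "a' \<in> H" "a \<otimes> y [^] i = a' \<otimes> y [^] j" for a a' and i j :: int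
  proof -
    have eq: "a \<otimes> y [^] (i - j) = a'"
    proof -
      have "a \<otimes> y [^] (i - j) = a \<otimes> y [^] i \<otimes> inv (y [^] j)"
        using that(1) Hc y by (simp add: int_pow_diff m_assoc)
      also have "\<dots> = (a' \<otimes> y [^] j) \<otimes> inv (y [^] j)"
        using that(3) by simp
      also have "\<dots> = a' \<otimes> (y [^] j \<otimes> inv (y [^] j))"
        using that(2) Hc y by (intro m_assoc) auto
      also have "\<dots> = a'"
        using that(2) Hc y by simp
      finally show ?thesis .
    qed
    have "y [^] (i - j) = inv a \<otimes> a'"
      using eq that Hc y inv_solve_left by (metis int_pow_closed)
    then have "y [^] (i - j) \<in> H"
      using that H by (simp add: subgroup.m_closed subgroup.m_inv_closed)
    then obtain t where t: "i - j = int p * t"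
      using int_pow_mem_subgroup_imp_dvd[OF p H y] by (metis dvdE)
    have mem: "(y [^] int p) [^] t \<in> H"
      using subgroup_int_pow_closed[OF H y(3)] .
    have "a' = a \<otimes> (y [^] int p) [^] t"
      using eq y by (simp add: t int_pow_pow)
    then have "[\<chi> a' = \<chi> a + \<chi> ((y [^] int p) [^] t)] (mod m)"
      using chi mem that by (simp add: residue_char_def)
    moreover have "[\<chi> ((y [^] int p) [^] t) = t * (int p * v)] (mod m)"
      using cong_trans[OF residue_char_int_pow[OF H chi y(3)] cong_scalar_left[OF cong_sym[OF v]]] .
    ultimately have "[\<chi> a' = \<chi> a + t * (int p * v)] (mod m)"
      using cong_add_lcancel cong_trans by blast
    then have "[\<chi> a' + j * v = \<chi> a + t * (int p * v) + j * v] (mod m)"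
      using cong_add_rcancel by blast
    moreover have "\<chi> a + t * (int p * v) + j * v = \<chi> a + (j + (i - j)) * v"
      unfolding t by (simp add: algebra_simps)
    ultimately show ?thesis
      by (simp add: cong_sym)
  qed
  define rep where "rep u = (SOME (a, i). a \<in> H \<and> u = a \<otimes> y [^] (i::int))" for u
  define \<chi>' where "\<chi>' u = \<chi> (fst (rep u)) + snd (rep u) * v" for u
  have val: "[\<chi>' (a \<otimes> y [^] i) = \<chi> a + i * v] (mod m)" if "a \<in> H" for a and i :: int
  proof -
    have "case rep (a \<otimes> y [^] i) of (a', j) \<Rightarrow> a' \<in> H \<and> a \<otimes> y [^] i = a' \<otimes> y [^] j"
      unfolding rep_def by (rule someI[where x = "(a, i)"]) (use that in auto)
    then show ?thesis
      unfolding \<chi>'_def using well[of "fst (rep (a \<otimes> y [^] i))" a] that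
      by (auto split: prod.splits)
  qed
  have prod: "(a \<otimes> y [^] i) \<otimes> (a' \<otimes> y [^] j) = (a \<otimes> a') \<otimes> y [^] (i + j)"
    if "a \<in> H" "a' \<in> H" for a a' and i j :: int
    using that Hc y by (simp add: int_pow_mult m_ac)
  have "subgroup H' G"
  proof (rule subgroupI)
    show "H' \<subseteq> carrier G"
      using Hc y by (auto simp: H'_def)
    show "H' \<noteq> {}"
      using subgroup.one_closed[OF H] by (auto simp: H'_def)
    show "inv u \<in> H'" if u': "u \<in> H'" for u
    proof -
      obtain a i where u: "a \<in> H" "u = a \<otimes> y [^] (i::int)"
        using u' unfolding H'_def by blast
      have "inv u = inv a \<otimes> y [^] (- i)"
        using u Hc y by (simp add: inv_mult int_pow_neg)
      then show ?thesis
        unfolding H'_def using u subgroup.m_inv_closed[OF H] by blast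
    qed
    show "u \<otimes> w \<in> H'" if uw: "u \<in> H'" "w \<in> H'" for u w
    proof -
      obtain a i a' j where "a \<in> H" "u = a \<otimes> y [^] (i::int)" "a' \<in> H" "w = a' \<otimes> y [^] (j::int)"
        using uw unfolding H'_def by blast
      then show ?thesis
        unfolding H'_def using prod[of a a' i j] subgroup.m_closed[OF H, of a a'] by blast
    qed
  qed
  moreover have "H \<subseteq> H'"
  proof
    fix a assume "a \<in> H"
    then have "a = a \<otimes> y [^] (0::int)"
      using Hc by simp
    then show "a \<in> H'"
      unfolding H'_def using \<open>a \<in> H\<close> by blast
  qed
  moreover have y_eq: "y = \<one> \<otimes> y [^] (1::int)"
    using y by simp
  then have "y \<in> H'"
    unfolding H'_def using subgroup.one_closed[OF H] by blast
  moreover have "residue_char G H' m \<chi>'"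
    unfolding residue_char_def
  proof (intro ballI)
    fix u w assume "u \<in> H'" "w \<in> H'"
    then obtain a i a' j where u: "a \<in> H" "u = a \<otimes> y [^] (i::int)"
      and w: "a' \<in> H" "w = a' \<otimes> y [^] (j::int)"
      unfolding H'_def by blast
    have "[\<chi>' (u \<otimes> w) = \<chi> (a \<otimes> a') + (i + j) * v] (mod m)"
      using u w prod val subgroup.m_closed[OF H] by simp
    moreover have "[\<chi> (a \<otimes> a') + (i + j) * v = (\<chi> a + \<chi> a') + (i + j) * v] (mod m)"
      using chi u w by (intro cong_add) (auto simp: residue_char_def)
    moreover have "[\<chi>' u + \<chi>' w = (\<chi> a + i * v) + (\<chi> a' + j * v)] (mod m)"
      using u w val by (intro cong_add) auto
    moreover have "(\<chi> a + i * v) + (\<chi> a' + j * v) = (\<chi> a + \<chi> a') + (i + j) * v"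
      by (simp add: algebra_simps)
    ultimately show "[\<chi>' (u \<otimes> w) = \<chi>' u + \<chi>' w] (mod m)"
      by (metis cong_sym cong_trans)
  qed
  moreover have "\<forall>x\<in>H. [\<chi>' x = \<chi> x] (mod m)"
    using val[where i = 0] Hc by simp
  moreover have "[\<chi>' y = v] (mod m)"
  proof -
    have "[\<chi> \<one> = 0] (mod m)"
      using residue_char_int_pow[OF H chi, of \<one> 0] subgroup.one_closed[OF H] by simp
    then have "[\<chi> \<one> + 1 * v = 0 + 1 * v] (mod m)"
      by (intro cong_add) auto
    then show ?thesis
      using val[OF subgroup.one_closed[OF H], of 1] y cong_trans by fastforce
  qed
  ultimately show ?thesis
    by blast
qed

lemma exists_last_power_outside:
  assumes "y \<notin> H" "y [^] (int p ^ j) \<in> H" "y \<in> carrier G"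
  shows "\<exists>i. y [^] (int p ^ i) \<notin> H \<and> (y [^] (int p ^ i)) [^] int p \<in> H"
proof -
  define i where "i = (LEAST i. y [^] (int p ^ i) \<in> H)"
  have i: "y [^] (int p ^ i) \<in> H"
    unfolding i_def using assms(2) by (rule LeastI)
  obtain i' where i': "i = Suc i'"
    using i assms by (cases i) auto
  then have "y [^] (int p ^ i') \<notin> H"
    unfolding i_def using not_less_Least by (metis lessI)
  then show ?thesis
    using i i' assms(3) by (auto simp: int_pow_pow mult.commute)
qed

text \<open>
  The integers modulo \<open>p ^ j\<close> are injective among groups of exponent dividing \<open>p ^ j\<close>. The
  hypothesis \<open>pows\<close> says that the character factors through the quotient of \<open>G\<close> by its
  \<open>p ^ j\<close>-th powers, which is such a group; working with it directly avoids the
  passage to cosets.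
\<close>

lemma extend_residue_char:
  assumes p: "prime p" and fin: "finite (carrier G)"
    and H: "subgroup H G" and chi: "residue_char G H (int p ^ j) \<chi>"
    and pows: "\<And>x. x \<in> carrier G \<Longrightarrow> x [^] (int p ^ j) \<in> H \<and> [\<chi> (x [^] (int p ^ j)) = 0] (mod (int p ^ j))"
  shows "\<exists>\<chi>'. residue_char G (carrier G) (int p ^ j) \<chi>' \<and>
           (\<forall>x\<in>H. [\<chi>' x = \<chi> x] (mod (int p ^ j)))"
  using H chi pows
proof (induction "card (carrier G - H)" arbitrary: H \<chi> rule: less_induct)
  case less
  note H = less.prems(1) and chi = less.prems(2) and pows = less.prems(3)
  show ?case
  proof (cases "H = carrier G")
    case True
    then show ?thesis
      using chi by auto
  next
    case False
    then obtain y0 where y0: "y0 \<in> carrier G" "y0 \<notin> H"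
      using subgroup.subset[OF H] by blast
    then obtain i where i: "y0 [^] (int p ^ i) \<notin> H" "(y0 [^] (int p ^ i)) [^] int p \<in> H"
      using exists_last_power_outside[of y0 H p j] pows by blast
    define y where "y = y0 [^] (int p ^ i)"
    have y: "y \<in> carrier G" "y \<notin> H" "y [^] int p \<in> H"
      using i y0 by (auto simp: y_def)
    \<comment> \<open>The value at the \<open>p\<close>-th power of \<open>y\<close> is killed by \<open>p ^ (j - 1)\<close>, hence divisible by \<open>p\<close>.\<close>
    have "\<exists>v. [int p * v = \<chi> (y [^] int p)] (mod (int p ^ j))"
    proof (cases j)
      case 0
      then show ?thesis by auto
    next
      case (Suc j')
      have "y [^] (int p ^ j) = (y [^] int p) [^] (int p ^ j')"
        using y by (simp add: Suc int_pow_pow)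
      then have "[int p ^ j' * \<chi> (y [^] int p) = 0] (mod (int p ^ j))"
        using residue_char_int_pow[OF H chi y(3), of "int p ^ j'"] pows[OF y(1)]
        by (metis cong_sym cong_trans)
      then have "int p ^ j' * int p dvd int p ^ j' * \<chi> (y [^] int p)"
        by (simp add: cong_0_iff Suc mult.commute)
      then have "int p dvd \<chi> (y [^] int p)"
        using p by (simp add: prime_gt_0_nat)
      then show ?thesis
        by (metis cong_refl dvdE)
    qed
    then obtain v where "[int p * v = \<chi> (y [^] int p)] (mod (int p ^ j))"
      by blast
    from extend_residue_char_step[OF p H chi y this]
    obtain H' \<chi>' where H': "subgroup H' G" "H \<subseteq> H'" "y \<in> H'" "residue_char G H' (int p ^ j) \<chi>'"
      "\<forall>x\<in>H. [\<chi>' x = \<chi> x] (mod (int p ^ j))"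
      by blast
    have "card (carrier G - H') < card (carrier G - H)"
      using H' y fin by (intro psubset_card_mono) auto
    moreover have "x [^] (int p ^ j) \<in> H' \<and> [\<chi>' (x [^] (int p ^ j)) = 0] (mod (int p ^ j))"
      if "x \<in> carrier G" for x
      using pows[OF that] H'(2,5) cong_trans[of "\<chi>' (x [^] (int p ^ j))" "\<chi> (x [^] (int p ^ j))"]
      by blast
    ultimately have "\<exists>\<chi>''. residue_char G (carrier G) (int p ^ j) \<chi>'' \<and>
        (\<forall>x\<in>H'. [\<chi>'' x = \<chi>' x] (mod (int p ^ j)))"
      by (rule less.hyps[OF _ H'(1,4)])
    then obtain \<chi>'' where chi'': "residue_char G (carrier G) (int p ^ j) \<chi>''"
      "\<forall>x\<in>H'. [\<chi>'' x = \<chi>' x] (mod (int p ^ j))"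
      by blast
    have "[\<chi>'' x = \<chi> x] (mod (int p ^ j))" if "x \<in> H" for x
      using chi''(2) H'(2,5) that cong_trans[of "\<chi>'' x" "\<chi>' x"] by blast
    then show ?thesis
      using chi''(1) by blast
  qed
qed

text \<open>
  Characters modulo \<open>p ^ j\<close> separate an element from the \<open>p ^ j\<close>-th powers. Some power \<open>z\<close> of
  \<open>y\<close> has order \<open>p\<close> modulo these powers. The zero character on them extends to \<open>z\<close> with the
  non-zero value \<open>p ^ (j - 1)\<close>, and then to the whole group.
\<close>

lemma residue_char_separates:
  assumes p: "prime p" and fin: "finite (carrier G)"
    and y: "y \<in> carrier G" "y \<notin> pow_set G (p ^ j)"
  shows "\<exists>\<chi>. residue_char G (carrier G) (int p ^ j) \<chi> \<and> \<not> int p ^ j dvd \<chi> y"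
proof -
  let ?N = "pow_set G (p ^ j)"
  have N: "subgroup ?N G"
    using subgroup_pow_set comm_group_axioms by blast
  have pow_N: "x [^] (int p ^ j) \<in> ?N" if "x \<in> carrier G" for x
    unfolding pow_set_iff[OF is_group] using that by blast
  obtain i where i: "y [^] (int p ^ i) \<notin> ?N" "(y [^] (int p ^ i)) [^] int p \<in> ?N"
    using exists_last_power_outside[of y ?N p j] y pow_N by blast
  define z where "z = y [^] (int p ^ i)"
  have z: "z \<in> carrier G" "z \<notin> ?N" "z [^] int p \<in> ?N"
    using i y by (auto simp: z_def)
  obtain j' where j': "j = Suc j'"
    using y pow_N[of y] by (cases j) auto
  have "residue_char G ?N (int p ^ j) (\<lambda>_. 0)"
    by (simp add: residue_char_def)
  moreover have "[int p * int p ^ j' = 0] (mod (int p ^ j))"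
    by (simp add: cong_0_iff j')
  ultimately have "\<exists>H' \<chi>'. subgroup H' G \<and> ?N \<subseteq> H' \<and> z \<in> H' \<and> residue_char G H' (int p ^ j) \<chi>' \<and>
      (\<forall>x\<in>?N. [\<chi>' x = 0] (mod (int p ^ j))) \<and> [\<chi>' z = int p ^ j'] (mod (int p ^ j))"
    by (rule extend_residue_char_step[OF p N _ z])
  then obtain H' \<chi>' where H': "subgroup H' G" "?N \<subseteq> H'" "z \<in> H'"
    "residue_char G H' (int p ^ j) \<chi>'" "\<forall>x\<in>?N. [\<chi>' x = 0] (mod (int p ^ j))"
    "[\<chi>' z = int p ^ j'] (mod (int p ^ j))"
    by blast
  have "x [^] (int p ^ j) \<in> H' \<and> [\<chi>' (x [^] (int p ^ j)) = 0] (mod (int p ^ j))"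
    if "x \<in> carrier G" for x
    using pow_N[OF that] H'(2,5) by blast
  from extend_residue_char[OF p fin H'(1,4) this]
  obtain \<chi> where chi: "residue_char G (carrier G) (int p ^ j) \<chi>"
    "\<forall>x\<in>H'. [\<chi> x = \<chi>' x] (mod (int p ^ j))"
    by blast
  have "[\<chi> z = int p ^ i * \<chi> y] (mod (int p ^ j))"
    unfolding z_def using residue_char_int_pow[OF subgroup_self chi(1)] y by simp
  moreover have "[\<chi> z = int p ^ j'] (mod (int p ^ j))"
    using chi(2) H'(3,6) cong_trans[of "\<chi> z" "\<chi>' z"] by blast
  moreover have "\<not> int p ^ j dvd int p ^ j'"
    using p prime_gt_1_nat[OF p] by (simp add: j')
  ultimately have "\<not> int p ^ j dvd int p ^ i * \<chi> y"
    using cong_dvd_iff[of "\<chi> z" "int p ^ i * \<chi> y" "int p ^ j"]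
      cong_dvd_iff[of "\<chi> z" "int p ^ j'" "int p ^ j"] by blast
  then have "\<not> int p ^ j dvd \<chi> y"
    by auto
  then show ?thesis
    using chi by blast
qed

end

lemma hom_of_residue_char:
  assumes "comm_group A" "r \<in> carrier A" "r [^]\<^bsub>A\<^esub> m = \<one>\<^bsub>A\<^esub>" "residue_char B (carrier B) m \<chi>"
  shows "(\<lambda>x. r [^]\<^bsub>A\<^esub> \<chi> x) \<in> hom B A"
proof -
  interpret A: comm_group A by fact
  show ?thesis
  proof (rule homI)
    fix x y assume "x \<in> carrier B" "y \<in> carrier B"
    then have "[\<chi> (x \<otimes>\<^bsub>B\<^esub> y) = \<chi> x + \<chi> y] (mod m)"
      using assms(4) by (simp add: residue_char_def)
    then show "r [^]\<^bsub>A\<^esub> \<chi> (x \<otimes>\<^bsub>B\<^esub> y) = r [^]\<^bsub>A\<^esub> \<chi> x \<otimes>\<^bsub>A\<^esub> r [^]\<^bsub>A\<^esub> \<chi> y"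
      unfolding A.int_pow_mult[OF assms(2), symmetric] by (rule A.int_pow_cong[OF assms(2,3)])
  qed (use assms(2) in simp)
qed


text \<open>
  When \<open>e\<close> has the maximal order \<open>p ^ Suc b\<close>, a character separating \<open>e [^] (p ^ b)\<close> from the unit
  takes a value prime to \<open>p\<close> at \<open>e\<close>, and can be rescaled. This amounts to the fact that
  the subgroup generated by \<open>e\<close> is a direct factor.
\<close>

lemma (in comm_group) exists_unit_residue_char:
  assumes p: "prime p" and fin: "finite (carrier G)"
    and exp: "\<And>x. x \<in> carrier G \<Longrightarrow> x [^] (int p ^ Suc b) = \<one>"
    and e: "e \<in> carrier G" "e [^] (int p ^ b) \<noteq> \<one>"
  shows "\<exists>\<chi>. residue_char G (carrier G) (int p ^ Suc b) \<chi> \<and> [\<chi> e = 1] (mod (int p ^ Suc b))"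
proof -
  have "e [^] (int p ^ b) \<notin> pow_set G (p ^ Suc b)"
  proof
    assume "e [^] (int p ^ b) \<in> pow_set G (p ^ Suc b)"
    then obtain x where x: "x \<in> carrier G" "e [^] (int p ^ b) = x [^] (int p ^ Suc b)"
      unfolding pow_set_iff[OF is_group] by blast
    show False
      using e(2) unfolding x(2) exp[OF x(1)] by simp
  qed
  moreover have "e [^] (int p ^ b) \<in> carrier G"
    using e(1) by simp
  ultimately have "\<exists>\<psi>. residue_char G (carrier G) (int p ^ Suc b) \<psi> \<and>
      \<not> int p ^ Suc b dvd \<psi> (e [^] (int p ^ b))"
    by (intro residue_char_separates[OF p fin])
  then obtain \<psi> where psi: "residue_char G (carrier G) (int p ^ Suc b) \<psi>"
    "\<not> int p ^ Suc b dvd \<psi> (e [^] (int p ^ b))"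
    by blast
  have "[\<psi> (e [^] (int p ^ b)) = int p ^ b * \<psi> e] (mod (int p ^ Suc b))"
    by (rule residue_char_int_pow[OF subgroup_self psi(1) e(1)])
  then have "\<not> int p ^ Suc b dvd int p ^ b * \<psi> e"
    using psi(2) cong_dvd_iff by blast
  then have "\<not> int p dvd \<psi> e"
    by auto
  then have "coprime (\<psi> e) (int p ^ Suc b)"
    using p prime_imp_coprime[of "int p" "\<psi> e"] by (simp add: coprime_commute)
  then obtain v where v: "[\<psi> e * v = 1] (mod (int p ^ Suc b))"
    using cong_solve_coprime_int by blast
  have "residue_char G (carrier G) (int p ^ Suc b) (\<lambda>x. \<psi> x * v)"
    unfolding residue_char_def
  proof (intro ballI)
    fix x y assume "x \<in> carrier G" "y \<in> carrier G"
    then have "[\<psi> (x \<otimes> y) * v = (\<psi> x + \<psi> y) * v] (mod (int p ^ Suc b))"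
      using psi(1) unfolding residue_char_def by (intro cong_scalar_right) blast
    then show "[\<psi> (x \<otimes> y) * v = \<psi> x * v + \<psi> y * v] (mod (int p ^ Suc b))"
      by (simp only: distrib_right)
  qed
  with v show ?thesis
    by blast
qed

section \<open>Elements reached by homomorphisms\<close>

text \<open>
  The exponent of \<open>R\<close> is \<open>p ^ n\<close>, and \<open>\<chi>\<close> is a projection of \<open>B\<close> onto the integers modulo \<open>p ^ b\<close>
  in which \<open>e\<close> has coordinate \<open>1\<close>.
\<close>

locale p_exponent_hom = A: comm_group A + B: comm_group B
  for A :: "('a, 'm) monoid_scheme" (structure) and B :: "('b, 'n) monoid_scheme" (structure) +
  fixes p b n :: nat and R :: "'a set" and l :: "'a \<Rightarrow> 'b" and e :: 'b and \<chi> :: "'b \<Rightarrow> int"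
  assumes prime: "prime p" and finite_B: "finite (carrier B)" and l_hom: "l \<in> hom A B"
    and R_eq: "R = {x \<in> carrier A. x [^]\<^bsub>A\<^esub> (int p ^ b) = \<one>\<^bsub>A\<^esub>}"
    and B_exponent: "x \<in> carrier B \<Longrightarrow> x [^]\<^bsub>B\<^esub> (int p ^ b) = \<one>\<^bsub>B\<^esub>"
    and e_carrier: "e \<in> carrier B"
    and chi: "residue_char B (carrier B) (int p ^ b) \<chi>"
    and chi_e: "[\<chi> e = 1] (mod (int p ^ b))"
    and n_le_b: "n \<le> b"
    and R_exponent: "s \<in> R \<Longrightarrow> s [^]\<^bsub>A\<^esub> (int p ^ n) = \<one>\<^bsub>A\<^esub>"
    and R_exponent_least: "i < n \<Longrightarrow> \<exists>s\<in>R. s [^]\<^bsub>A\<^esub> (int p ^ i) \<noteq> \<one>\<^bsub>A\<^esub>"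
begin

lemma R_carrier: "s \<in> R \<Longrightarrow> s \<in> carrier A"
  by (simp add: R_eq)

lemma R_pow_b: "s \<in> R \<Longrightarrow> s [^]\<^bsub>A\<^esub> (int p ^ b) = \<one>\<^bsub>A\<^esub>"
  by (simp add: R_eq)

lemma l_carrier: "s \<in> carrier A \<Longrightarrow> l s \<in> carrier B"
  using l_hom by (rule hom_in_carrier)

lemma l_mult: "s \<in> carrier A \<Longrightarrow> t \<in> carrier A \<Longrightarrow> l (s \<otimes>\<^bsub>A\<^esub> t) = l s \<otimes>\<^bsub>B\<^esub> l t"
  using l_hom by (rule hom_mult)

lemma l_int_pow: "s \<in> carrier A \<Longrightarrow> l (s [^]\<^bsub>A\<^esub> (i::int)) = l s [^]\<^bsub>B\<^esub> i"
  by (rule hom_int_pow[OF l_hom _ A.is_group B.is_group])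

lemma hom_int_pow_BA:
  "f \<in> hom B A \<Longrightarrow> x \<in> carrier B \<Longrightarrow> f (x [^]\<^bsub>B\<^esub> (i::int)) = f x [^]\<^bsub>A\<^esub> i"
  by (rule hom_int_pow[OF _ _ B.is_group A.is_group])

lemma R_subgroup: "subgroup R A"
proof (rule A.subgroupI)
  show "R \<subseteq> carrier A" "R \<noteq> {}"
    by (auto simp: R_eq intro!: exI[of _ "\<one>\<^bsub>A\<^esub>"])
  show "inv\<^bsub>A\<^esub> a \<in> R" if "a \<in> R" for a
    using that by (simp add: R_eq A.int_pow_inv)
  show "a \<otimes>\<^bsub>A\<^esub> c \<in> R" if "a \<in> R" "c \<in> R" for a c
    using that by (simp add: R_eq A.int_pow_distrib)
qed

lemma R_int_pow: "s \<in> R \<Longrightarrow> s [^]\<^bsub>A\<^esub> (i::int) \<in> R"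
  using A.subgroup_int_pow_closed[OF R_subgroup] .

lemma hom_in_R:
  assumes "f \<in> hom B A" "x \<in> carrier B"
  shows "f x \<in> R"
  using hom_int_pow_BA[OF assms, of "int p ^ b"] hom_in_carrier[OF assms]
    B_exponent[OF assms(2)] hom_one[OF assms(1) B.is_group A.is_group]
  by (simp add: R_eq)

text \<open>
  Together with \<open>R_pow_chi_e\<close>: every \<open>s \<in> R\<close> is the image of \<open>e\<close> under a homomorphism.
\<close>

lemma chi_hom: "s \<in> R \<Longrightarrow> (\<lambda>x. s [^]\<^bsub>A\<^esub> \<chi> x) \<in> hom B A"
  by (rule hom_of_residue_char[OF A.comm_group_axioms R_carrier R_pow_b chi])

lemma R_int_pow_cong:
  "s \<in> R \<Longrightarrow> [i = j] (mod (int p ^ b)) \<Longrightarrow> s [^]\<^bsub>A\<^esub> i = s [^]\<^bsub>A\<^esub> j"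
  by (rule A.int_pow_cong[OF R_carrier R_pow_b])

lemma R_pow_chi_e: "s \<in> R \<Longrightarrow> s [^]\<^bsub>A\<^esub> \<chi> e = s"
  using R_int_pow_cong[OF _ chi_e, of s] R_carrier by simp

lemma chi_int_pow: "x \<in> carrier B \<Longrightarrow> [\<chi> (x [^]\<^bsub>B\<^esub> i) = i * \<chi> x] (mod (int p ^ b))" for i :: int
  by (rule B.residue_char_int_pow[OF B.subgroup_self chi])

lemma chi_mult:
  "x \<in> carrier B \<Longrightarrow> y \<in> carrier B \<Longrightarrow> [\<chi> (x \<otimes>\<^bsub>B\<^esub> y) = \<chi> x + \<chi> y] (mod (int p ^ b))"
  using chi unfolding residue_char_def by blast

lemma chi_one: "[\<chi> \<one>\<^bsub>B\<^esub> = 0] (mod (int p ^ b))"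
  using chi_int_pow[of "\<one>\<^bsub>B\<^esub>" 0] by simp

lemma R_int_pow_dvd: "s \<in> R \<Longrightarrow> int p ^ n dvd z \<Longrightarrow> s [^]\<^bsub>A\<^esub> z = \<one>\<^bsub>A\<^esub>"
  by (rule A.int_pow_eq_one_of_dvd[OF R_carrier R_exponent])

section \<open>Cyclic quotient implies non-trivial c-map\<close>

text \<open>
  Modulo elements killed by both \<open>l\<close> and \<open>p ^ k\<close>, everything in \<open>R\<close> is a power of \<open>r\<close>. If \<open>f a\<close>,
  \<open>g a\<close> correspond to the exponents \<open>\<alpha>\<close>, \<open>\<beta>\<close>, and the \<open>p ^ k\<close>-th power of \<open>x\<close> is \<open>l r [^] m\<close>, then
  \<open>f (l (g x))\<close> is the power of \<open>r\<close> with exponent \<open>p ^ k * m * \<alpha> * \<beta>\<close>, which is symmetric in \<open>f\<close>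
  and \<open>g\<close>.
\<close>

lemma nontrivial_c_map_of_cyclic_image:
  assumes k: "k < n" and r: "r \<in> R"
    and gen: "\<And>s. s \<in> R \<Longrightarrow>
      \<exists>m::int. \<exists>w\<in>R. l w = \<one>\<^bsub>B\<^esub> \<and> w [^]\<^bsub>A\<^esub> (int p ^ k) = \<one>\<^bsub>A\<^esub> \<and> s = r [^]\<^bsub>A\<^esub> m \<otimes>\<^bsub>A\<^esub> w"
    and a: "a \<in> carrier B" "l r = a [^]\<^bsub>B\<^esub> (int p ^ k)"
    and img: "\<And>x. x \<in> carrier B \<Longrightarrow> \<exists>m::int. x [^]\<^bsub>B\<^esub> (int p ^ k) = l r [^]\<^bsub>B\<^esub> m"
  shows "nontrivial_c_map A B l"
proof -
  let ?q = "int p ^ k"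
  note rc = R_carrier[OF r]
  have pow_q: "\<exists>\<alpha>::int. s [^]\<^bsub>A\<^esub> ?q = r [^]\<^bsub>A\<^esub> (?q * \<alpha>) \<and> l s = l r [^]\<^bsub>B\<^esub> \<alpha>" if "s \<in> R" for s
  proof -
    obtain \<alpha> :: int and w where w: "w \<in> R" "l w = \<one>\<^bsub>B\<^esub>" "w [^]\<^bsub>A\<^esub> ?q = \<one>\<^bsub>A\<^esub>"
      and s: "s = r [^]\<^bsub>A\<^esub> \<alpha> \<otimes>\<^bsub>A\<^esub> w"
      using gen[OF \<open>s \<in> R\<close>] by blast
    have "s [^]\<^bsub>A\<^esub> ?q = (r [^]\<^bsub>A\<^esub> \<alpha>) [^]\<^bsub>A\<^esub> ?q"
      unfolding s using w R_carrier[OF w(1)] rc by (simp add: A.int_pow_distrib)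
    moreover have "l s = l r [^]\<^bsub>B\<^esub> \<alpha>"
      unfolding s using w(2) R_carrier[OF w(1)] rc by (simp add: l_mult l_int_pow l_carrier)
    ultimately show ?thesis
      using rc by (auto simp: A.int_pow_pow mult.commute)
  qed
  have val: "f (l (g x)) = r [^]\<^bsub>A\<^esub> (?q * (m * \<alpha> * \<beta>))"
    if f: "f \<in> hom B A" and g: "g \<in> hom B A" and x: "x \<in> carrier B"
      and m: "x [^]\<^bsub>B\<^esub> ?q = l r [^]\<^bsub>B\<^esub> m"
      and \<alpha>: "f a [^]\<^bsub>A\<^esub> ?q = r [^]\<^bsub>A\<^esub> (?q * \<alpha>)" and \<beta>: "g a [^]\<^bsub>A\<^esub> ?q = r [^]\<^bsub>A\<^esub> (?q * \<beta>)"
    for f g x and m \<alpha> \<beta> :: int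
  proof -
    have gx: "g x \<in> R" and fa: "f a \<in> carrier A" and ga: "g a \<in> carrier A"
      using hom_in_R[OF g x] hom_in_R[OF f a(1)] hom_in_R[OF g a(1)] R_carrier by auto
    obtain \<sigma> :: int where s: "g x [^]\<^bsub>A\<^esub> ?q = r [^]\<^bsub>A\<^esub> (?q * \<sigma>)" "l (g x) = l r [^]\<^bsub>B\<^esub> \<sigma>"
      using pow_q[OF gx] by blast
    have "f (l (g x)) = f (a [^]\<^bsub>B\<^esub> (?q * \<sigma>))"
      unfolding s(2) a(2) using a(1) by (simp add: B.int_pow_pow)
    also have "\<dots> = (f a [^]\<^bsub>A\<^esub> ?q) [^]\<^bsub>A\<^esub> \<sigma>"
      using fa by (simp add: hom_int_pow_BA[OF f a(1)] A.int_pow_pow)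
    also have "\<dots> = (g x [^]\<^bsub>A\<^esub> ?q) [^]\<^bsub>A\<^esub> \<alpha>"
      unfolding \<alpha> s(1) using rc by (simp add: A.int_pow_pow mult_ac)
    also have "g x [^]\<^bsub>A\<^esub> ?q = g (x [^]\<^bsub>B\<^esub> ?q)"
      by (simp add: hom_int_pow_BA[OF g x])
    also have "x [^]\<^bsub>B\<^esub> ?q = a [^]\<^bsub>B\<^esub> (?q * m)"
      unfolding m a(2) using a(1) by (simp add: B.int_pow_pow)
    also have "g (a [^]\<^bsub>B\<^esub> (?q * m)) = (g a [^]\<^bsub>A\<^esub> ?q) [^]\<^bsub>A\<^esub> m"
      using ga by (simp add: hom_int_pow_BA[OF g a(1)] A.int_pow_pow)
    also have "\<dots> [^]\<^bsub>A\<^esub> \<alpha> = r [^]\<^bsub>A\<^esub> (?q * (m * \<alpha> * \<beta>))"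
      unfolding \<beta> using rc by (simp add: A.int_pow_pow mult_ac)
    finally show ?thesis .
  qed
  have "c_map A B l"
    unfolding c_map_def
  proof (intro conjI ballI l_hom)
    fix f g x assume f: "f \<in> hom B A" and g: "g \<in> hom B A" and x: "x \<in> carrier B"
    obtain m :: int where m: "x [^]\<^bsub>B\<^esub> ?q = l r [^]\<^bsub>B\<^esub> m"
      using img[OF x] by blast
    obtain \<alpha> \<beta> :: int where "f a [^]\<^bsub>A\<^esub> ?q = r [^]\<^bsub>A\<^esub> (?q * \<alpha>)" "g a [^]\<^bsub>A\<^esub> ?q = r [^]\<^bsub>A\<^esub> (?q * \<beta>)"
      using pow_q[OF hom_in_R[OF f a(1)]] pow_q[OF hom_in_R[OF g a(1)]] by blast
    then show "f (l (g x)) = g (l (f x))"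
      using val[OF f g x m] val[OF g f x m] by (simp add: mult_ac)
  qed
  \<comment> \<open>With \<open>f = g\<close> sending \<open>e\<close> to \<open>r\<close>, the composite at \<open>e\<close> is a unit multiple of the \<open>p ^ k\<close>-th power
      of \<open>r\<close>; were it trivial, all of \<open>R\<close> would be killed by \<open>p ^ k\<close>, below its exponent.\<close>
  moreover have "\<not> trivial_c_map A B l"
  proof
    assume triv: "trivial_c_map A B l"
    have "r [^]\<^bsub>A\<^esub> \<chi> (l (r [^]\<^bsub>A\<^esub> \<chi> e)) = \<one>\<^bsub>A\<^esub>"
      by (rule triv[unfolded trivial_c_map_def, THEN conjunct2, rule_format,
            OF chi_hom[OF r] chi_hom[OF r] e_carrier])
    then have "r [^]\<^bsub>A\<^esub> \<chi> (a [^]\<^bsub>B\<^esub> ?q) = \<one>\<^bsub>A\<^esub>"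
      by (simp only: R_pow_chi_e[OF r] a(2))
    then have r1: "r [^]\<^bsub>A\<^esub> (?q * \<chi> a) = \<one>\<^bsub>A\<^esub>"
      using R_int_pow_cong[OF r chi_int_pow[OF a(1), of ?q]] by simp
    obtain m :: int where "e [^]\<^bsub>B\<^esub> ?q = l r [^]\<^bsub>B\<^esub> m"
      using img[OF e_carrier] by blast
    then have "e [^]\<^bsub>B\<^esub> ?q = a [^]\<^bsub>B\<^esub> (?q * m)"
      unfolding a(2) using a(1) by (simp add: B.int_pow_pow)
    then have "[?q * \<chi> e = ?q * m * \<chi> a] (mod (int p ^ b))"
      using chi_int_pow[OF e_carrier, of ?q] chi_int_pow[OF a(1), of "?q * m"]
      by (metis cong_sym cong_trans)
    then have "[?q * 1 = ?q * m * \<chi> a] (mod (int p ^ b))"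
      using cong_scalar_left[OF chi_e, of ?q] cong_sym cong_trans by blast
    then have "int p ^ b dvd ?q * (1 - m * \<chi> a)"
      by (simp add: cong_iff_dvd_diff algebra_simps)
    moreover have "int p ^ Suc k dvd int p ^ b"
      using k n_le_b by (intro le_imp_power_dvd) simp
    ultimately have "?q * int p dvd ?q * (1 - m * \<chi> a)"
      by (metis dvd_trans power_Suc2)
    then have "int p dvd 1 - m * \<chi> a"
      using prime by (simp add: prime_gt_0_nat)
    moreover have "\<not> int p dvd 1"
      using prime_gt_1_nat[OF prime] by simp
    ultimately have "\<not> int p dvd \<chi> a"
      using dvd_add[of "int p" "1 - m * \<chi> a" "m * \<chi> a"] by auto
    then have "coprime (\<chi> a) (int p ^ b)"
      using prime prime_imp_coprime[of "int p" "\<chi> a"] by (simp add: coprime_commute)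
    then have r_q: "r [^]\<^bsub>A\<^esub> ?q = \<one>\<^bsub>A\<^esub>"
      by (rule A.int_pow_eq_one_cancel_coprime[OF rc R_pow_b[OF r] _ r1])
    obtain s where "s \<in> R" "s [^]\<^bsub>A\<^esub> ?q \<noteq> \<one>\<^bsub>A\<^esub>"
      using R_exponent_least[OF k] by blast
    moreover obtain \<alpha> :: int where "s [^]\<^bsub>A\<^esub> ?q = r [^]\<^bsub>A\<^esub> (?q * \<alpha>)"
      using pow_q[OF \<open>s \<in> R\<close>] by blast
    ultimately show False
      using A.int_pow_eq_one_of_dvd[OF rc r_q, of "?q * \<alpha>"] by simp
  qed
  ultimately show ?thesis
    unfolding nontrivial_c_map_def by blast
qed

section \<open>Structure forced by a non-trivial c-map\<close>

text \<open>
  The c-map condition for \<open>f\<close> and the homomorphism \<open>x \<mapsto> s [^] \<chi> x\<close>; all later consequences of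
  the condition are drawn from this identity.
\<close>

lemma c_map_eval:
  assumes c: "c_map A B l" and f: "f \<in> hom B A" and s: "s \<in> R" and x: "x \<in> carrier B"
  shows "f (l s) [^]\<^bsub>A\<^esub> \<chi> x = s [^]\<^bsub>A\<^esub> \<chi> (l (f x))"
proof -
  have "f (l (s [^]\<^bsub>A\<^esub> \<chi> x)) = s [^]\<^bsub>A\<^esub> \<chi> (l (f x))"
    by (rule c[unfolded c_map_def, THEN conjunct2, rule_format, OF f chi_hom[OF s] x])
  then show ?thesis
    using R_carrier[OF s] f l_carrier by (simp add: l_int_pow hom_int_pow_BA)
qed

lemma c_map_eval_e:
  assumes "c_map A B l" and f: "f \<in> hom B A" and "s \<in> R"
  shows "f (l s) = s [^]\<^bsub>A\<^esub> \<chi> (l (f e))"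
  using c_map_eval[OF assms e_carrier]
  unfolding R_pow_chi_e[OF hom_in_R[OF f l_carrier[OF R_carrier[OF assms(3)]]]] .

lemma c_map_symmetric:
  assumes "c_map A B l" "r \<in> R" "s \<in> R"
  shows "r [^]\<^bsub>A\<^esub> \<chi> (l s) = s [^]\<^bsub>A\<^esub> \<chi> (l r)"
  using c_map_eval_e[OF assms(1) chi_hom[OF assms(2)] assms(3)] R_pow_chi_e[OF assms(2)] by simp

text \<open>
  By \<open>c_map_eval_e\<close>, every value of \<open>f \<circ> l \<circ> g\<close> is a power with an exponent of the form
  \<open>\<chi> (l s)\<close>; it vanishes if such exponents are multiples of the exponent of \<open>R\<close>.
\<close>

lemma nontrivial_c_map_imp_not_dvd:
  assumes "nontrivial_c_map A B l"
  shows "\<exists>s\<in>R. \<not> int p ^ n dvd \<chi> (l s)"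
proof (rule ccontr)
  assume all: "\<not> (\<exists>s\<in>R. \<not> int p ^ n dvd \<chi> (l s))"
  have c: "c_map A B l"
    using assms by (simp add: nontrivial_c_map_def)
  have "f (l (g x)) = \<one>\<^bsub>A\<^esub>" if f: "f \<in> hom B A" and g: "g \<in> hom B A" and x: "x \<in> carrier B" for f g x
    unfolding c_map_eval_e[OF c f hom_in_R[OF g x]]
    using all hom_in_R[OF f e_carrier] by (intro R_int_pow_dvd[OF hom_in_R[OF g x]]) blast
  then have "trivial_c_map A B l"
    using l_hom unfolding trivial_c_map_def by blast
  then show False
    using assms by (simp add: nontrivial_c_map_def)
qed

text \<open>
  The power \<open>p ^ k\<close> generates the subgroup of all values \<open>\<chi> (l s)\<close> modulo \<open>p ^ b\<close>.
\<close>

lemma exists_generator: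
  assumes "nontrivial_c_map A B l"
  shows "\<exists>k r. k < n \<and> r \<in> R \<and> (\<forall>s\<in>R. int p ^ k dvd \<chi> (l s)) \<and>
           [\<chi> (l r) = int p ^ k] (mod (int p ^ b))"
proof -
  define i where "i = (LEAST i. \<exists>s\<in>R. \<not> int p ^ i dvd \<chi> (l s))"
  have i: "\<exists>s\<in>R. \<not> int p ^ i dvd \<chi> (l s)"
    unfolding i_def using nontrivial_c_map_imp_not_dvd[OF assms] by (rule LeastI)
  have "i \<le> n"
    unfolding i_def using nontrivial_c_map_imp_not_dvd[OF assms] by (rule Least_le)
  obtain k where k: "i = Suc k"
    using i by (cases i) auto
  have dvd: "int p ^ k dvd \<chi> (l s)" if "s \<in> R" for s
    using not_less_Least[of k "\<lambda>i. \<exists>s\<in>R. \<not> int p ^ i dvd \<chi> (l s)"] that k unfolding i_def by auto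
  obtain s where s: "s \<in> R" "\<not> int p ^ Suc k dvd \<chi> (l s)"
    using i k by blast
  obtain u where u: "\<chi> (l s) = int p ^ k * u"
    using dvd[OF s(1)] by (rule dvdE)
  then have "\<not> int p dvd u"
    using s(2) by auto
  then have "coprime u (int p ^ b)"
    using prime prime_imp_coprime[of "int p" u] by (simp add: coprime_commute)
  then obtain v where v: "[u * v = 1] (mod (int p ^ b))"
    using cong_solve_coprime_int by blast
  have "[\<chi> (l (s [^]\<^bsub>A\<^esub> v)) = v * \<chi> (l s)] (mod (int p ^ b))"
    using chi_int_pow[of "l s" v] s(1) R_carrier by (simp add: l_int_pow l_carrier)
  moreover have "v * \<chi> (l s) = int p ^ k * (u * v)"
    by (simp add: u)
  moreover have "[int p ^ k * (u * v) = int p ^ k * 1] (mod (int p ^ b))"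
    by (rule cong_scalar_left[OF v])
  ultimately have "[\<chi> (l (s [^]\<^bsub>A\<^esub> v)) = int p ^ k] (mod (int p ^ b))"
    by (simp add: cong_def)
  then show ?thesis
    using dvd R_int_pow[OF s(1)] \<open>i \<le> n\<close> k by (intro exI[of _ k] exI[of _ "s [^]\<^bsub>A\<^esub> v"]) auto
qed

end

locale c_map_generator = p_exponent_hom +
  fixes k :: nat and r :: 'a
  assumes c: "c_map A B l" and k: "k < n" and r: "r \<in> R"
    and k_dvd: "s \<in> R \<Longrightarrow> int p ^ k dvd \<chi> (l s)"
    and chi_lr: "[\<chi> (l r) = int p ^ k] (mod (int p ^ b))"
begin

text \<open>
  This relation is the heart of the matter: the \<open>p ^ k\<close>-th powers of \<open>R\<close> all lie in the cyclic
  group generated by \<open>r\<close>.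
\<close>

lemma pow_k_eq: "s \<in> R \<Longrightarrow> s [^]\<^bsub>A\<^esub> (int p ^ k) = r [^]\<^bsub>A\<^esub> \<chi> (l s)"
  using c_map_symmetric[OF c r, of s] R_int_pow_cong[OF _ chi_lr, of s] by simp

text \<open>
  The order of \<open>r\<close> is the full exponent of \<open>R\<close>: as \<open>k < n\<close>, the highest non-trivial powers
  in \<open>R\<close> are already powers of \<open>r\<close>.
\<close>

lemma dvd_of_r_pow_eq_one:
  fixes z :: int
  assumes "r [^]\<^bsub>A\<^esub> z = \<one>\<^bsub>A\<^esub>"
  shows "int p ^ n dvd z"
proof -
  obtain n' where n': "n = Suc n'"
    using k by (cases n) auto
  have "r [^]\<^bsub>A\<^esub> (int p ^ n') \<noteq> \<one>\<^bsub>A\<^esub>"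
  proof
    assume one: "r [^]\<^bsub>A\<^esub> (int p ^ n') = \<one>\<^bsub>A\<^esub>"
    obtain s where s: "s \<in> R" "s [^]\<^bsub>A\<^esub> (int p ^ n') \<noteq> \<one>\<^bsub>A\<^esub>"
      using R_exponent_least[of n'] n' by auto
    have split: "int p ^ n' = int p ^ k * int p ^ (n' - k)"
      using k n' by (simp flip: power_add)
    have "s [^]\<^bsub>A\<^esub> (int p ^ n') = r [^]\<^bsub>A\<^esub> (\<chi> (l s) * int p ^ (n' - k))"
      unfolding split using pow_k_eq[OF s(1)] R_carrier[OF s(1)] R_carrier[OF r]
      by (simp flip: A.int_pow_pow)
    also have "\<dots> = \<one>\<^bsub>A\<^esub>"
      using k_dvd[OF s(1)] unfolding split
      by (intro A.int_pow_eq_one_of_dvd[OF R_carrier[OF r] one]) (simp add: split mult_dvd_mono)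
    finally show False
      using s(2) by simp
  qed
  then show ?thesis
    using A.prime_power_dvd_of_int_pow_eq_one[OF prime R_carrier[OF r] _ _ assms] R_exponent[OF r]
    unfolding n' by blast
qed

lemma mem_pow_n_of_homs_vanish:
  assumes y: "y \<in> carrier B" and van: "\<And>f. f \<in> hom B A \<Longrightarrow> f y = \<one>\<^bsub>A\<^esub>"
  shows "\<exists>z\<in>carrier B. y = z [^]\<^bsub>B\<^esub> (int p ^ n)"
proof (rule ccontr)
  assume "\<not> ?thesis"
  then have "y \<notin> pow_set B (p ^ n)"
    unfolding pow_set_iff[OF B.is_group] .
  then obtain \<psi> where psi: "residue_char B (carrier B) (int p ^ n) \<psi>" "\<not> int p ^ n dvd \<psi> y"
    using B.residue_char_separates[OF prime finite_B y] by blast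
  have "r [^]\<^bsub>A\<^esub> \<psi> y = \<one>\<^bsub>A\<^esub>"
    by (rule van[OF hom_of_residue_char[OF A.comm_group_axioms R_carrier[OF r] R_exponent[OF r] psi(1)]])
  then show False
    using dvd_of_r_pow_eq_one psi(2) by blast
qed

text \<open>
  The element \<open>r [^] d\<close> has order \<open>p ^ k\<close>. Every homomorphism \<open>f\<close> from \<open>B\<close> into the group that it
  generates kills \<open>l r\<close>, since \<open>f (l r)\<close> is \<open>r\<close> to the power \<open>\<chi> (l (f e))\<close>, a multiple of the
  order \<open>d * p ^ k = p ^ n\<close> of \<open>r\<close>. Such homomorphisms separate the \<open>p ^ k\<close>-th powers from all other elements.
\<close>

lemma image_generator_is_power:
  "\<exists>a\<in>carrier B. l r = a [^]\<^bsub>B\<^esub> (int p ^ k)"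
proof (rule ccontr)
  note rc = R_carrier[OF r]
  assume "\<not> ?thesis"
  then have "l r \<notin> pow_set B (p ^ k)"
    unfolding pow_set_iff[OF B.is_group] .
  then obtain \<psi> where psi: "residue_char B (carrier B) (int p ^ k) \<psi>" "\<not> int p ^ k dvd \<psi> (l r)"
    using B.residue_char_separates[OF prime finite_B l_carrier[OF rc]] by blast
  define d where "d = int p ^ (n - k)"
  have d: "d * int p ^ k = int p ^ n"
    using k by (simp add: d_def flip: power_add)
  have "(r [^]\<^bsub>A\<^esub> d) [^]\<^bsub>A\<^esub> (int p ^ k) = \<one>\<^bsub>A\<^esub>"
    using R_exponent[OF r] rc by (simp add: A.int_pow_pow d)
  then have f: "(\<lambda>x. (r [^]\<^bsub>A\<^esub> d) [^]\<^bsub>A\<^esub> \<psi> x) \<in> hom B A"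
    using hom_of_residue_char[OF A.comm_group_axioms _ _ psi(1)] rc by blast
  have "[\<chi> (l (r [^]\<^bsub>A\<^esub> (d * \<psi> e))) = d * \<psi> e * \<chi> (l r)] (mod (int p ^ b))"
    using chi_int_pow[OF l_carrier[OF rc]] rc by (simp add: l_int_pow)
  then have "[\<chi> (l (r [^]\<^bsub>A\<^esub> (d * \<psi> e))) = d * \<psi> e * int p ^ k] (mod (int p ^ b))"
    using cong_scalar_left[OF chi_lr] cong_trans by blast
  moreover have "d * \<psi> e * int p ^ k = int p ^ n * \<psi> e"
    by (simp flip: d)
  ultimately have "r [^]\<^bsub>A\<^esub> \<chi> (l (r [^]\<^bsub>A\<^esub> (d * \<psi> e))) = r [^]\<^bsub>A\<^esub> (int p ^ n * \<psi> e)"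
    using R_int_pow_cong[OF r] by simp
  also have "\<dots> = \<one>\<^bsub>A\<^esub>"
    by (rule R_int_pow_dvd[OF r]) simp
  finally have "r [^]\<^bsub>A\<^esub> (d * \<psi> (l r)) = \<one>\<^bsub>A\<^esub>"
    using c_map_eval_e[OF c f r] rc by (simp add: A.int_pow_pow)
  then have "d * int p ^ k dvd d * \<psi> (l r)"
    unfolding d by (rule dvd_of_r_pow_eq_one)
  moreover have "d \<noteq> 0"
    using prime by (simp add: d_def prime_gt_0_nat)
  ultimately show False
    using psi(2) by simp
qed

text \<open>
  Let \<open>l r\<close> be the \<open>p ^ k\<close>-th power of \<open>a\<close>. Then \<open>\<chi> a\<close> is a unit, so \<open>x\<close> can be changed by a power of
  \<open>a\<close> into an element \<open>y\<close> with \<open>\<chi> y = 0\<close>. By \<open>c_map_eval\<close> all homomorphisms to \<open>A\<close> kill the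
  \<open>p ^ k\<close>-th power of such a \<open>y\<close>.
\<close>

lemma pow_k_mod_pow_n:
  assumes x: "x \<in> carrier B"
  shows "\<exists>m::int. \<exists>z\<in>carrier B. x [^]\<^bsub>B\<^esub> (int p ^ k) = l r [^]\<^bsub>B\<^esub> m \<otimes>\<^bsub>B\<^esub> z [^]\<^bsub>B\<^esub> (int p ^ n)"
proof -
  note rc = R_carrier[OF r]
  obtain a where a: "a \<in> carrier B" "l r = a [^]\<^bsub>B\<^esub> (int p ^ k)"
    using image_generator_is_power by blast
  have "[int p ^ k * \<chi> a = int p ^ k] (mod (int p ^ b))"
    using chi_int_pow[OF a(1)] chi_lr unfolding a(2) by (metis cong_sym cong_trans)
  then have "int p ^ b dvd int p ^ k * (\<chi> a - 1)"
    by (simp add: cong_iff_dvd_diff algebra_simps)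
  moreover have "int p ^ k * int p dvd int p ^ b"
    using le_imp_power_dvd[of "Suc k" b "int p"] k n_le_b by (simp add: mult.commute)
  ultimately have "int p ^ k * int p dvd int p ^ k * (\<chi> a - 1)"
    using dvd_trans by blast
  then have "int p dvd \<chi> a - 1"
    using prime by (simp add: prime_gt_0_nat)
  moreover have "\<not> int p dvd 1"
    using prime_gt_1_nat[OF prime] by simp
  ultimately have "\<not> int p dvd \<chi> a"
    using dvd_diff[of "int p" "\<chi> a" "\<chi> a - 1"] by auto
  then have "coprime (\<chi> a) (int p ^ b)"
    using prime prime_imp_coprime[of "int p" "\<chi> a"] by (simp add: coprime_commute)
  then obtain v where v: "[\<chi> a * v = 1] (mod (int p ^ b))"
    using cong_solve_coprime_int by blast
  define m where "m = \<chi> x * v"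
  define y where "y = x \<otimes>\<^bsub>B\<^esub> a [^]\<^bsub>B\<^esub> (- m)"
  have y: "y \<in> carrier B"
    using x a by (simp add: y_def)
  have "[\<chi> y = \<chi> x + - m * \<chi> a] (mod (int p ^ b))"
    unfolding y_def using chi_mult[OF x, of "a [^]\<^bsub>B\<^esub> (- m)"] chi_int_pow[OF a(1), of "- m"] a(1)
    by (meson B.int_pow_closed cong_add_lcancel cong_trans)
  then have "[\<chi> y = \<chi> x - \<chi> x * (\<chi> a * v)] (mod (int p ^ b))"
    by (simp add: m_def mult_ac)
  moreover have "[\<chi> x - \<chi> x * (\<chi> a * v) = \<chi> x - \<chi> x * 1] (mod (int p ^ b))"
    by (intro cong_diff cong_refl cong_scalar_left[OF v])
  ultimately have chi_y: "[\<chi> y = 0] (mod (int p ^ b))"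
    using cong_trans by fastforce
  have "f (y [^]\<^bsub>B\<^esub> (int p ^ k)) = \<one>\<^bsub>A\<^esub>" if f: "f \<in> hom B A" for f
  proof -
    have "f (y [^]\<^bsub>B\<^esub> (int p ^ k)) = r [^]\<^bsub>A\<^esub> \<chi> (l (f y))"
      using pow_k_eq[OF hom_in_R[OF f y]] hom_int_pow_BA[OF f y] by simp
    also have "\<dots> = f (l r) [^]\<^bsub>A\<^esub> \<chi> y"
      using c_map_eval[OF c f r y] by simp
    also have "\<dots> = \<one>\<^bsub>A\<^esub>"
      using R_int_pow_cong[OF hom_in_R[OF f l_carrier[OF rc]] chi_y] by simp
    finally show ?thesis .
  qed
  moreover have "y [^]\<^bsub>B\<^esub> (int p ^ k) \<in> carrier B"
    using y by simp
  ultimately obtain z where z: "z \<in> carrier B" "y [^]\<^bsub>B\<^esub> (int p ^ k) = z [^]\<^bsub>B\<^esub> (int p ^ n)"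
    using mem_pow_n_of_homs_vanish by blast
  have "x = a [^]\<^bsub>B\<^esub> m \<otimes>\<^bsub>B\<^esub> y"
    unfolding y_def using x a(1)
    by (simp add: B.m_lcomm[of _ x] flip: B.int_pow_mult)
  then have "x [^]\<^bsub>B\<^esub> (int p ^ k) = (a [^]\<^bsub>B\<^esub> m) [^]\<^bsub>B\<^esub> (int p ^ k) \<otimes>\<^bsub>B\<^esub> y [^]\<^bsub>B\<^esub> (int p ^ k)"
    using a(1) y by (simp add: B.int_pow_distrib)
  also have "(a [^]\<^bsub>B\<^esub> m) [^]\<^bsub>B\<^esub> (int p ^ k) = l r [^]\<^bsub>B\<^esub> m"
    unfolding a(2) using a(1) by (simp add: B.int_pow_pow mult.commute)
  finally show ?thesis
    unfolding z(2) using z(1) by blast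
qed

text \<open>
  A Nakayama argument: since \<open>k < n\<close>, substituting \<open>pow_k_mod_pow_n\<close> into itself pushes the error
  term into ever higher powers.
\<close>

lemma pow_k_mod_higher_pow:
  assumes x: "x \<in> carrier B"
  shows "\<exists>m::int. \<exists>z\<in>carrier B. x [^]\<^bsub>B\<^esub> (int p ^ k) = l r [^]\<^bsub>B\<^esub> m \<otimes>\<^bsub>B\<^esub> z [^]\<^bsub>B\<^esub> (int p ^ (k + i))"
proof (induction i)
  case 0
  then show ?case
    using x l_carrier[OF R_carrier[OF r]] by (intro exI[of _ 0] bexI[of _ x]) auto
next
  case (Suc i)
  note lr = l_carrier[OF R_carrier[OF r]]
  obtain m :: int and z where z: "z \<in> carrier B"
    and xz: "x [^]\<^bsub>B\<^esub> (int p ^ k) = l r [^]\<^bsub>B\<^esub> m \<otimes>\<^bsub>B\<^esub> z [^]\<^bsub>B\<^esub> (int p ^ (k + i))"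
    using Suc by blast
  obtain m' :: int and w where w: "w \<in> carrier B"
    and zw: "z [^]\<^bsub>B\<^esub> (int p ^ k) = l r [^]\<^bsub>B\<^esub> m' \<otimes>\<^bsub>B\<^esub> w [^]\<^bsub>B\<^esub> (int p ^ n)"
    using pow_k_mod_pow_n[OF z] by blast
  define c where "c = int p ^ (n - Suc k)"
  have c: "int p ^ n * int p ^ i = c * int p ^ (k + Suc i)"
    unfolding c_def power_add[symmetric] using k by simp
  have "z [^]\<^bsub>B\<^esub> (int p ^ (k + i)) = (z [^]\<^bsub>B\<^esub> (int p ^ k)) [^]\<^bsub>B\<^esub> (int p ^ i)"
    using z by (simp add: B.int_pow_pow power_add)
  also have "\<dots> = l r [^]\<^bsub>B\<^esub> (m' * int p ^ i) \<otimes>\<^bsub>B\<^esub> w [^]\<^bsub>B\<^esub> (int p ^ n * int p ^ i)"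
    unfolding zw using lr w by (simp add: B.int_pow_distrib B.int_pow_pow)
  also have "\<dots> = l r [^]\<^bsub>B\<^esub> (m' * int p ^ i) \<otimes>\<^bsub>B\<^esub> (w [^]\<^bsub>B\<^esub> c) [^]\<^bsub>B\<^esub> (int p ^ (k + Suc i))"
    unfolding c using w by (simp add: B.int_pow_pow)
  finally have "x [^]\<^bsub>B\<^esub> (int p ^ k) =
      l r [^]\<^bsub>B\<^esub> (m + m' * int p ^ i) \<otimes>\<^bsub>B\<^esub> (w [^]\<^bsub>B\<^esub> c) [^]\<^bsub>B\<^esub> (int p ^ (k + Suc i))"
    unfolding xz using lr w by (simp add: B.int_pow_mult B.m_assoc)
  then show ?case
    using w B.int_pow_closed by blast
qed

lemma pow_k_in_span:
  assumes x: "x \<in> carrier B"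
  shows "\<exists>m::int. x [^]\<^bsub>B\<^esub> (int p ^ k) = l r [^]\<^bsub>B\<^esub> m"
proof -
  obtain m :: int and z where z: "z \<in> carrier B"
    and xz: "x [^]\<^bsub>B\<^esub> (int p ^ k) = l r [^]\<^bsub>B\<^esub> m \<otimes>\<^bsub>B\<^esub> z [^]\<^bsub>B\<^esub> (int p ^ (k + b))"
    using pow_k_mod_higher_pow[OF x] by blast
  have "z [^]\<^bsub>B\<^esub> (int p ^ (k + b)) = \<one>\<^bsub>B\<^esub>"
    by (rule B.int_pow_eq_one_of_dvd[OF z B_exponent[OF z]]) (simp add: power_add)
  then show ?thesis
    using xz l_carrier[OF R_carrier[OF r]] by auto
qed

text \<open>
  For \<open>s \<in> R\<close> with \<open>\<chi> (l s) = p ^ k * \<tau>\<close> the element \<open>t\<close>, which is \<open>s\<close> divided by \<open>r [^] \<tau>\<close>, is killed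
  by \<open>p ^ k\<close>. Hence every homomorphism to \<open>A\<close> kills \<open>l t\<close>, and \<open>l t\<close> is a \<open>p ^ n\<close>-th power.
\<close>

lemma image_eq: "l ` R = pow_set B (p ^ k)"
proof
  note rc = R_carrier[OF r]
  show "l ` R \<subseteq> pow_set B (p ^ k)"
  proof
    fix y assume "y \<in> l ` R"
    then obtain s where s: "s \<in> R" "y = l s"
      by blast
    obtain \<tau> where \<tau>: "\<chi> (l s) = int p ^ k * \<tau>"
      using k_dvd[OF s(1)] by (rule dvdE)
    define t where "t = s \<otimes>\<^bsub>A\<^esub> r [^]\<^bsub>A\<^esub> (- \<tau>)"
    have t: "t \<in> R"
      unfolding t_def by (rule subgroup.m_closed[OF R_subgroup s(1) R_int_pow[OF r]])
    have "t [^]\<^bsub>A\<^esub> (int p ^ k) = r [^]\<^bsub>A\<^esub> (\<chi> (l s)) \<otimes>\<^bsub>A\<^esub> r [^]\<^bsub>A\<^esub> (- \<tau> * int p ^ k)"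
      unfolding t_def using R_carrier[OF s(1)] rc
      by (simp add: A.int_pow_distrib A.int_pow_pow pow_k_eq[OF s(1)])
    also have "\<dots> = \<one>\<^bsub>A\<^esub>"
      unfolding A.int_pow_mult[OF rc, symmetric] by (simp add: \<tau>)
    finally have t_k: "t [^]\<^bsub>A\<^esub> (int p ^ k) = \<one>\<^bsub>A\<^esub>" .
    have "f (l t) = \<one>\<^bsub>A\<^esub>" if f: "f \<in> hom B A" for f
      unfolding c_map_eval_e[OF c f t]
      by (rule A.int_pow_eq_one_of_dvd[OF R_carrier[OF t] t_k k_dvd[OF hom_in_R[OF f e_carrier]]])
    then obtain z where z: "z \<in> carrier B" "l t = z [^]\<^bsub>B\<^esub> (int p ^ n)"
      using mem_pow_n_of_homs_vanish[OF l_carrier[OF R_carrier[OF t]]] by blast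
    have "int p ^ n = int p ^ (n - k) * int p ^ k"
      using k by (simp flip: power_add)
    then have "l t = (z [^]\<^bsub>B\<^esub> (int p ^ (n - k))) [^]\<^bsub>B\<^esub> (int p ^ k)"
      using z by (simp add: B.int_pow_pow)
    then have lt: "l t \<in> pow_set B (p ^ k)"
      unfolding pow_set_iff[OF B.is_group] using z(1) B.int_pow_closed by blast
    have "l r \<in> pow_set B (p ^ k)"
      unfolding pow_set_iff[OF B.is_group] using image_generator_is_power .
    then have "l r [^]\<^bsub>B\<^esub> \<tau> \<in> pow_set B (p ^ k)"
      by (rule B.subgroup_int_pow_closed[OF subgroup_pow_set[OF B.comm_group_axioms]])
    moreover have "s = t \<otimes>\<^bsub>A\<^esub> r [^]\<^bsub>A\<^esub> \<tau>"
      unfolding t_def using R_carrier[OF s(1)] rc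
      by (simp add: A.m_assoc flip: A.int_pow_mult)
    then have "y = l t \<otimes>\<^bsub>B\<^esub> l r [^]\<^bsub>B\<^esub> \<tau>"
      unfolding s(2) using R_carrier[OF t] rc by (simp add: l_mult l_int_pow)
    ultimately show "y \<in> pow_set B (p ^ k)"
      using lt subgroup.m_closed[OF subgroup_pow_set[OF B.comm_group_axioms]] by blast
  qed
  show "pow_set B (p ^ k) \<subseteq> l ` R"
  proof
    fix y assume "y \<in> pow_set B (p ^ k)"
    then obtain m :: int where "y = l r [^]\<^bsub>B\<^esub> m"
      unfolding pow_set_iff[OF B.is_group] using pow_k_in_span by blast
    then have "y = l (r [^]\<^bsub>A\<^esub> m)"
      using rc by (simp add: l_int_pow)
    then show "y \<in> l ` R"
      using R_int_pow[OF r] by blast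
  qed
qed

lemma kernel_pow_k:
  assumes "s \<in> R" "l s = \<one>\<^bsub>B\<^esub>"
  shows "s [^]\<^bsub>A\<^esub> (int p ^ k) = \<one>\<^bsub>A\<^esub>"
  using pow_k_eq[OF assms(1)] R_int_pow_cong[OF r chi_one] assms(2) by simp

text \<open>
  Induction on \<open>i\<close> shows that a \<open>p\<close>-power torsion element of the kernel lies in \<open>R\<close>: its \<open>p\<close>-th
  power is killed by \<open>p ^ k\<close>, and \<open>k + 1 \<le> b\<close>.
\<close>

lemma kernel_element_pow_k:
  assumes "s \<in> carrier A" "l s = \<one>\<^bsub>B\<^esub>" "s [^]\<^bsub>A\<^esub> (int p ^ i) = \<one>\<^bsub>A\<^esub>"
  shows "s [^]\<^bsub>A\<^esub> (int p ^ k) = \<one>\<^bsub>A\<^esub>"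
  using assms
proof (induction i arbitrary: s)
  case 0
  then show ?case
    by simp
next
  case (Suc i)
  have "(s [^]\<^bsub>A\<^esub> int p) [^]\<^bsub>A\<^esub> (int p ^ k) = \<one>\<^bsub>A\<^esub>"
    using Suc by (intro Suc.IH) (simp_all add: l_int_pow A.int_pow_pow)
  then have "s [^]\<^bsub>A\<^esub> (int p ^ Suc k) = \<one>\<^bsub>A\<^esub>"
    using Suc.prems(1) by (simp add: A.int_pow_pow)
  moreover have "int p ^ Suc k dvd int p ^ b"
    using k n_le_b by (intro le_imp_power_dvd) simp
  ultimately have "s \<in> R"
    using A.int_pow_eq_one_of_dvd[OF Suc.prems(1)] Suc.prems(1) by (simp add: R_eq)
  then show ?case
    using kernel_pow_k Suc.prems(2) by blast
qed

end

section \<open>Exponents of subsets and cyclic quotients\<close>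

lemma (in group) group_exp_subset:
  assumes fin: "finite (carrier G)" and S: "S \<subseteq> carrier G" and N: "N = group_exp (G\<lparr>carrier := S\<rparr>)"
  shows "x \<in> S \<Longrightarrow> x [^] N = \<one>"
    and "0 < j \<Longrightarrow> (\<And>x. x \<in> S \<Longrightarrow> x [^] j = \<one>) \<Longrightarrow> N \<le> j"
proof -
  have eq: "N = (LEAST n. n > 0 \<and> (\<forall>x\<in>S. x [^] n = \<one>))"
    unfolding N group_exp_def by (simp flip: nat_pow_consistent)
  have "order G > 0 \<and> (\<forall>x\<in>S. x [^] order G = \<one>)"
    using fin S pow_order_eq_1 order_gt_0_iff_finite by blast
  then have "N > 0 \<and> (\<forall>x\<in>S. x [^] N = \<one>)"
    unfolding eq by (rule LeastI)
  then show "x \<in> S \<Longrightarrow> x [^] N = \<one>"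
    by blast
  show "0 < j \<Longrightarrow> (\<And>x. x \<in> S \<Longrightarrow> x [^] j = \<one>) \<Longrightarrow> N \<le> j"
    unfolding eq by (rule Least_le) blast
qed

lemma (in comm_group) cyclic_quotient_iff:
  assumes N: "subgroup N G"
  shows "cyclic_group (G Mod N) \<longleftrightarrow>
    (\<exists>r\<in>carrier G. \<forall>s\<in>carrier G. \<exists>m::int. \<exists>w\<in>N. s = r [^] m \<otimes> w)"
proof -
  interpret N: normal N G
    using subgroup_imp_normal[OF N] .
  interpret Q: group "G Mod N"
    by (rule N.factorgroup_is_group)
  have Nc: "w \<in> carrier G" if "w \<in> N" for w
    using N that subgroup.mem_carrier by metis
  have coset_eq: "N #> s = N #> t \<longleftrightarrow> (\<exists>w\<in>N. s = t \<otimes> w)"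
    if "s \<in> carrier G" "t \<in> carrier G" for s t
  proof
    assume "N #> s = N #> t"
    then have "s \<in> N #> t"
      using rcos_self[OF that(1) N] by simp
    then show "\<exists>w\<in>N. s = t \<otimes> w"
      using Nc that(2) m_comm unfolding r_coset_def by auto
  next
    assume "\<exists>w\<in>N. s = t \<otimes> w"
    then have "s \<in> N #> t"
      using Nc that(2) m_comm unfolding r_coset_def by auto
    then show "N #> s = N #> t"
      using repr_independence[OF _ that(2) N] by simp
  qed
  have carrier_Q: "carrier (G Mod N) = (\<lambda>s. N #> s) ` carrier G"
    by (auto simp: FactGroup_def RCOSETS_def)
  have pow_Q: "(N #> r) [^]\<^bsub>G Mod N\<^esub> m = N #> (r [^] m)" if "r \<in> carrier G" for r and m :: int
    using N.FactGroup_int_pow[OF that] .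
  have "carrier (G Mod N) = range (\<lambda>m::int. (N #> r) [^]\<^bsub>G Mod N\<^esub> m) \<longleftrightarrow>
      (\<forall>s\<in>carrier G. \<exists>m::int. \<exists>w\<in>N. s = r [^] m \<otimes> w)" if r: "r \<in> carrier G" for r
  proof -
    have "range (\<lambda>m::int. (N #> r) [^]\<^bsub>G Mod N\<^esub> m) \<subseteq> carrier (G Mod N)"
      unfolding pow_Q[OF r] carrier_Q using r by blast
    then have "carrier (G Mod N) = range (\<lambda>m::int. (N #> r) [^]\<^bsub>G Mod N\<^esub> m) \<longleftrightarrow>
        (\<forall>s\<in>carrier G. \<exists>m::int. N #> s = N #> (r [^] m))"
      unfolding pow_Q[OF r] carrier_Q by (simp add: set_eq_subset image_subset_iff) blast
    also have "\<dots> \<longleftrightarrow> (\<forall>s\<in>carrier G. \<exists>m::int. \<exists>w\<in>N. s = r [^] m \<otimes> w)"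
      using coset_eq r by simp
    finally show ?thesis .
  qed
  then show ?thesis
    unfolding Q.cyclic_group unfolding carrier_Q by simp
qed

section \<open>Characterization of non-trivial c-maps\<close>

theorem theorem3p10:
  fixes p b n1 c :: nat
    and A :: "('a, 'm) monoid_scheme"
    and B :: "('b, 'n) monoid_scheme"
    and l :: "'a \<Rightarrow> 'b"
    and R :: "'a set"
  assumes "prime p"
    and "abelian_p_group p A" and "finite (carrier A)" and "carrier A \<noteq> {\<one>\<^bsub>A\<^esub>}"
    and "abelian_p_group p B" and "finite (carrier B)" and "carrier B \<noteq> {\<one>\<^bsub>B\<^esub>}"
    and "l \<in> hom A B"
    and "p ^ b = group_exp B"
    and "R = {x \<in> carrier A. group.ord A x \<le> p ^ b}"
    and "p ^ n1 = group_exp (A\<lparr>carrier := R\<rparr>)"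
    and "p ^ c = group_exp (A\<lparr>carrier := kernel A B l\<rparr>)"
  shows "nontrivial_c_map A B l \<longleftrightarrow>
           (\<exists>k. c \<le> k \<and> k < n1 \<and> l ` R = pow_set B (p ^ k)) \<and>
           cyclic_group ((A\<lparr>carrier := R\<rparr>) Mod (kernel A B l))"
proof -
  note p = assms(1) and l_hom = assms(8)
  have p1: "1 < p"
    using p by (rule prime_gt_1_nat)
  interpret A: comm_group A
    using assms(2) by (simp add: abelian_p_group_def)
  interpret B: comm_group B
    using assms(5) by (simp add: abelian_p_group_def)
  let ?K = "kernel A B l"
  have ord_A: "\<exists>i. A.ord x = p ^ i" if "x \<in> carrier A" for x
    using assms(2) that by (simp add: abelian_p_group_def)
  have R_eq: "R = {x \<in> carrier A. x [^]\<^bsub>A\<^esub> (int p ^ b) = \<one>\<^bsub>A\<^esub>}"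
  proof -
    have "A.ord x \<le> p ^ b \<longleftrightarrow> x [^]\<^bsub>A\<^esub> (int p ^ b) = \<one>\<^bsub>A\<^esub>" if x: "x \<in> carrier A" for x
    proof -
      obtain i where i: "A.ord x = p ^ i"
        using ord_A[OF x] by blast
      have "p ^ i \<le> p ^ b \<longleftrightarrow> p ^ i dvd p ^ b"
        using p1 dvd_power_iff_le[of p i b] by simp
      then show ?thesis
        unfolding A.int_pow_of_nat_power A.pow_eq_id[OF x] i .
    qed
    then show ?thesis
      unfolding assms(10) by blast
  qed
  have R_sub: "R \<subseteq> carrier A" and K_sub: "?K \<subseteq> carrier A"
    by (auto simp: R_eq kernel_def)
  have B_exp: "p ^ b = group_exp (B\<lparr>carrier := carrier B\<rparr>)"
    using assms(9) by simp
  have exp_B: "x [^]\<^bsub>B\<^esub> (int p ^ b) = \<one>\<^bsub>B\<^esub>" if "x \<in> carrier B" for x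
    using B.group_exp_subset(1)[OF assms(6) subset_refl B_exp that] by (simp add: B.int_pow_of_nat_power)
  have exp_R: "s [^]\<^bsub>A\<^esub> (int p ^ n1) = \<one>\<^bsub>A\<^esub>" if "s \<in> R" for s
    using A.group_exp_subset(1)[OF assms(3) R_sub assms(11) that] by (simp add: A.int_pow_of_nat_power)
  have exp_K: "s [^]\<^bsub>A\<^esub> (int p ^ c) = \<one>\<^bsub>A\<^esub>" if "s \<in> ?K" for s
    using A.group_exp_subset(1)[OF assms(3) K_sub assms(12) that] by (simp add: A.int_pow_of_nat_power)
  have least_B: "b \<le> i" if "\<And>x. x \<in> carrier B \<Longrightarrow> x [^]\<^bsub>B\<^esub> (int p ^ i) = \<one>\<^bsub>B\<^esub>" for i
    using B.group_exp_subset(2)[OF assms(6) subset_refl B_exp, of "p ^ i"] that p1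
    by (simp add: B.int_pow_of_nat_power)
  have least_R: "n1 \<le> i" if "\<And>x. x \<in> R \<Longrightarrow> x [^]\<^bsub>A\<^esub> (int p ^ i) = \<one>\<^bsub>A\<^esub>" for i
    using A.group_exp_subset(2)[OF assms(3) R_sub assms(11), of "p ^ i"] that p1
    by (simp add: A.int_pow_of_nat_power)
  have least_K: "c \<le> i" if "\<And>x. x \<in> ?K \<Longrightarrow> x [^]\<^bsub>A\<^esub> (int p ^ i) = \<one>\<^bsub>A\<^esub>" for i
    using A.group_exp_subset(2)[OF assms(3) K_sub assms(12), of "p ^ i"] that p1
    by (simp add: A.int_pow_of_nat_power)
  have "b \<noteq> 0"
  proof
    assume "b = 0"
    then have "x = \<one>\<^bsub>B\<^esub>" if "x \<in> carrier B" for x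
      using exp_B[OF that] that by simp
    then show False
      using assms(7) B.one_closed by blast
  qed
  then obtain b' where b': "b = Suc b'"
    using not0_implies_Suc by blast
  obtain e where e: "e \<in> carrier B" "e [^]\<^bsub>B\<^esub> (int p ^ b') \<noteq> \<one>\<^bsub>B\<^esub>"
    using least_B[of b'] b' by auto
  obtain \<chi> where chi: "residue_char B (carrier B) (int p ^ b) \<chi>" "[\<chi> e = 1] (mod (int p ^ b))"
    using B.exists_unit_residue_char[OF p assms(6) exp_B[unfolded b'] e] unfolding b' by blast
  interpret p_exponent_hom A B p b n1 R l e \<chi>
  proof unfold_locales
    show "n1 \<le> b"
      using least_R[of b] by (simp add: R_eq)
    show "\<exists>s\<in>R. s [^]\<^bsub>A\<^esub> (int p ^ i) \<noteq> \<one>\<^bsub>A\<^esub>" if "i < n1" for i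
      using least_R[of i] that by (meson not_less)
  qed (use p assms(6) l_hom R_eq exp_B e chi exp_R in auto)
  interpret RG: comm_group "A\<lparr>carrier := R\<rparr>"
    using A.subgroup_imp_group[OF R_subgroup] R_carrier A.m_comm
    by (intro group.group_comm_groupI) auto
  have K_subgroup: "subgroup ?K A"
    using l_hom A.is_group B.is_group
    by (intro group_hom.subgroup_kernel) (simp add: group_hom_def group_hom_axioms_def)
  \<comment> \<open>Only when the kernel is contained in \<open>R\<close> is \<open>Mod\<close> a genuine quotient; either side of the
      equivalence forces this.\<close>
  have cyclic_iff: "cyclic_group ((A\<lparr>carrier := R\<rparr>) Mod ?K) \<longleftrightarrow>
      (\<exists>r\<in>R. \<forall>s\<in>R. \<exists>m::int. \<exists>w\<in>?K. s = r [^]\<^bsub>A\<^esub> m \<otimes>\<^bsub>A\<^esub> w)" if "?K \<subseteq> R"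
    using RG.cyclic_quotient_iff[OF A.subgroup_incl[OF K_subgroup R_subgroup that]]
    by (simp add: A.int_pow_consistent[OF R_subgroup, symmetric])
  show ?thesis
  proof (intro iffI; (elim conjE exE)?)
    assume nt: "nontrivial_c_map A B l"
    obtain k r where k: "k < n1" and r: "r \<in> R" and dvd: "\<And>s. s \<in> R \<Longrightarrow> int p ^ k dvd \<chi> (l s)"
      and chi_lr: "[\<chi> (l r) = int p ^ k] (mod (int p ^ b))"
      using exists_generator[OF nt] by blast
    interpret c_map_generator A B p b n1 R l e \<chi> k r
      using nt k r dvd chi_lr by unfold_locales (auto simp: nontrivial_c_map_def)
    have K_pow: "s [^]\<^bsub>A\<^esub> (int p ^ k) = \<one>\<^bsub>A\<^esub>" if "s \<in> ?K" for s
      using that exp_K[OF that] kernel_element_pow_k[of s c] by (simp add: kernel_def)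
    have "?K \<subseteq> R"
    proof
      fix s assume s: "s \<in> ?K"
      have "int p ^ k dvd int p ^ b"
        using k n_le_b by (intro le_imp_power_dvd) simp
      then show "s \<in> R"
        using s K_sub A.int_pow_eq_one_of_dvd[OF _ K_pow[OF s]] unfolding R_eq by blast
    qed
    moreover have "\<exists>m::int. \<exists>w\<in>?K. s = r [^]\<^bsub>A\<^esub> m \<otimes>\<^bsub>A\<^esub> w" if s: "s \<in> R" for s
    proof -
      note sc = R_carrier[OF s] and rc = R_carrier[OF r]
      have "l s \<in> pow_set B (p ^ k)"
        using image_eq s by blast
      then obtain x where x: "x \<in> carrier B" "l s = x [^]\<^bsub>B\<^esub> (int p ^ k)"
        unfolding pow_set_iff[OF B.is_group] by blast
      obtain m :: int where m: "l s = l r [^]\<^bsub>B\<^esub> m"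
        unfolding x(2) using pow_k_in_span[OF x(1)] by blast
      define w where "w = s \<otimes>\<^bsub>A\<^esub> r [^]\<^bsub>A\<^esub> (- m)"
      have "l w = \<one>\<^bsub>B\<^esub>"
        unfolding w_def using sc rc l_carrier[OF rc]
        by (simp add: l_mult l_int_pow m flip: B.int_pow_mult)
      then have "w \<in> ?K"
        using sc rc by (simp add: kernel_def w_def)
      moreover have "s = r [^]\<^bsub>A\<^esub> m \<otimes>\<^bsub>A\<^esub> w"
        unfolding w_def using sc rc by (simp add: A.m_lcomm[of _ s] flip: A.int_pow_mult)
      ultimately show ?thesis
        by blast
    qed
    ultimately have "cyclic_group ((A\<lparr>carrier := R\<rparr>) Mod ?K)"
      using cyclic_iff r by blast
    moreover have "c \<le> k"
      using least_K K_pow by blast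
    ultimately show "(\<exists>k. c \<le> k \<and> k < n1 \<and> l ` R = pow_set B (p ^ k)) \<and>
        cyclic_group ((A\<lparr>carrier := R\<rparr>) Mod ?K)"
      using k image_eq by blast
  next
    fix k assume cyc: "cyclic_group ((A\<lparr>carrier := R\<rparr>) Mod ?K)"
      and ck: "c \<le> k" and k: "k < n1" and img: "l ` R = pow_set B (p ^ k)"
    have K_pow: "s [^]\<^bsub>A\<^esub> (int p ^ i) = \<one>\<^bsub>A\<^esub>" if "s \<in> ?K" "c \<le> i" for s i
      using that K_sub by (intro A.int_pow_eq_one_of_dvd[OF _ exp_K]) (auto simp: le_imp_power_dvd)
    have K_R: "?K \<subseteq> R"
      using K_pow[of _ b] K_sub ck k n_le_b unfolding R_eq by auto
    obtain r where r: "r \<in> R" and gen: "\<And>s. s \<in> R \<Longrightarrow> \<exists>m::int. \<exists>w\<in>?K. s = r [^]\<^bsub>A\<^esub> m \<otimes>\<^bsub>A\<^esub> w"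
      using cyc cyclic_iff[OF K_R] by blast
    have "l r \<in> pow_set B (p ^ k)"
      using img r by blast
    then obtain a where a: "a \<in> carrier B" "l r = a [^]\<^bsub>B\<^esub> (int p ^ k)"
      unfolding pow_set_iff[OF B.is_group] by blast
    show "nontrivial_c_map A B l"
    proof (rule nontrivial_c_map_of_cyclic_image[OF k r _ a])
      show "\<exists>m::int. \<exists>w\<in>R. l w = \<one>\<^bsub>B\<^esub> \<and> w [^]\<^bsub>A\<^esub> (int p ^ k) = \<one>\<^bsub>A\<^esub> \<and> s = r [^]\<^bsub>A\<^esub> m \<otimes>\<^bsub>A\<^esub> w"
        if s: "s \<in> R" for s
      proof -
        obtain m :: int and w where w: "w \<in> ?K" "s = r [^]\<^bsub>A\<^esub> m \<otimes>\<^bsub>A\<^esub> w"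
          using gen[OF s] by blast
        then show ?thesis
          using K_R K_pow[OF w(1) ck] unfolding kernel_def by blast
      qed
      show "\<exists>m::int. x [^]\<^bsub>B\<^esub> (int p ^ k) = l r [^]\<^bsub>B\<^esub> m" if x: "x \<in> carrier B" for x
      proof -
        have "x [^]\<^bsub>B\<^esub> (int p ^ k) \<in> l ` R"
          unfolding img pow_set_iff[OF B.is_group] using x by blast
        then obtain s where s: "s \<in> R" "x [^]\<^bsub>B\<^esub> (int p ^ k) = l s"
          by blast
        obtain m :: int and w where w: "w \<in> carrier A" "l w = \<one>\<^bsub>B\<^esub>" "s = r [^]\<^bsub>A\<^esub> m \<otimes>\<^bsub>A\<^esub> w"
          using gen[OF s(1)] unfolding kernel_def by blast
        have "l s = l r [^]\<^bsub>B\<^esub> m"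
          using w R_carrier[OF r] by (simp add: l_mult l_int_pow l_carrier)
        then show ?thesis
          using s(2) by auto
      qed
    qed
  qed
qed

end
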